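(* Let $R=\bigoplus_{\alpha\in\Gamma}R_{\alpha}$ be a gGD domain and let $P$ be a homogeneous prime ideal of $R$. Then $R/P$ (with its induced $\Gamma$-grading) is a gGD domain.
   Context: All rings are commutative with identity. $\Gamma$ is a nonzero torsionless commutative cancellative monoid, written additively (torsionless is equivalent to the existence of a total order compatible with the monoid operation), with quotient group $\langle\Gamma\rangle$. A graded domain $R=\bigoplus_{\alpha\in\Gamma}R_\alpha$ is an integral domain graded by $\Gamma$; $H=\bigcup_{\alpha\in\Gamma}(R_\alpha\setminus\{0\})$ is its set of nonzero homogeneous elements. The homogeneous quotient field $R_H$ is graded by $\langle\Gamma\rangle$ via $\deg(a/b)=\deg(a)-\deg(b)$. A homogeneous overring of $R$ is a ring $T$ with $R\subseteq T\subseteq R_H$ and $T=\bigoplus_{\alpha\in\langle\Gamma\rangle}(T\cap(R_H)_\alpha)$; it is a $\langle\Gamma\rangle$-graded domain. An ideal is homogeneous if it is generated by homogeneous elements. For a homogeneous ideal $I=\bigoplus_\alpha I_\alpha$, the ring $R/I$ is $\Gamma$-graded with $(R/I)_\alpha=R_\alpha/I_\alpha$. For a homogeneous overring $T$ of $R$, the extension $R\subseteq T$ satisfies gGD (graded going-down) if, whenever $P_0\subseteq P$ are homogeneous prime ideals of $R$ and $Q$ is a homogeneous prime ideal of $T$ with $Q\cap R=P$, there is a homogeneous prime ideal $Q_0$ of $T$ with $Q_0\subseteq Q$ and $Q_0\cap R=P_0$. $R$ is a gGD domain if $R\subseteq T$ satisfies gGD for every homogeneous overring $T$ of $R$. *)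

theory Defs
  imports "HOL-Algebra.QuotRing" "HOL-Algebra.Subrings"
begin

text \<open>
  Grading monoids and their quotient groups are written multiplicatively, so that the library's
  monoids can be used: the degree \<open>\<alpha> + \<beta>\<close> in additive notation is \<open>\<alpha> \<otimes> \<beta>\<close>, the degree \<open>0\<close> is \<open>\<one>\<close>,
  and \<open>n \<alpha>\<close> is \<open>\<alpha> [^] n\<close>.
\<close>

locale grading_monoid = comm_monoid \<Gamma> for \<Gamma> :: "('g, 'm) monoid_scheme" (structure) +
  assumes cancel: "\<lbrakk>\<alpha> \<in> carrier \<Gamma>; \<beta> \<in> carrier \<Gamma>; \<gamma> \<in> carrier \<Gamma>; \<alpha> \<otimes> \<gamma> = \<beta> \<otimes> \<gamma>\<rbrakk> \<Longrightarrow> \<alpha> = \<beta>"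
    and torsionless: "\<lbrakk>\<alpha> \<in> carrier \<Gamma>; \<beta> \<in> carrier \<Gamma>; 0 < (n::nat); \<alpha> [^] n = \<beta> [^] n\<rbrakk> \<Longrightarrow> \<alpha> = \<beta>"
    and nonzero: "carrier \<Gamma> \<noteq> {\<one>}"


subsection \<open>Fractions\<close>

text \<open>
  The class of the fraction \<open>a/b\<close> with numerators in \<open>M\<close> and denominators in \<open>S\<close>. It is only used
  for submonoids \<open>S\<close> of \<open>M\<close> consisting of cancellable elements, so no further factor from \<open>S\<close> is
  needed in the relation.
\<close>

definition fraction :: "('a, 'm) monoid_scheme \<Rightarrow> 'a set \<Rightarrow> 'a \<Rightarrow> 'a \<Rightarrow> ('a \<times> 'a) set" where
  "fraction M S a b = {(c, d). c \<in> carrier M \<and> d \<in> S \<and> a \<otimes>\<^bsub>M\<^esub> d = c \<otimes>\<^bsub>M\<^esub> b}"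

text \<open>
  As in \<^const>\<open>FactRing\<close>, the operations are unions over all representatives; all members of such
  a union coincide (see \<open>quotient_group_mult\<close>, \<open>fraction_mult\<close>
  and \<open>fraction_add\<close> below).
\<close>

definition quotient_group :: "('g, 'm) monoid_scheme \<Rightarrow> ('g \<times> 'g) set monoid" where
  "quotient_group \<Gamma> =
    \<lparr>carrier = {fraction \<Gamma> (carrier \<Gamma>) \<alpha> \<beta> | \<alpha> \<beta>. \<alpha> \<in> carrier \<Gamma> \<and> \<beta> \<in> carrier \<Gamma>},
     mult = (\<lambda>U V. \<Union>x\<in>U. \<Union>y\<in>V.
              fraction \<Gamma> (carrier \<Gamma>) (fst x \<otimes>\<^bsub>\<Gamma>\<^esub> fst y) (snd x \<otimes>\<^bsub>\<Gamma>\<^esub> snd y)),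
     one = fraction \<Gamma> (carrier \<Gamma>) \<one>\<^bsub>\<Gamma>\<^esub> \<one>\<^bsub>\<Gamma>\<^esub>\<rparr>"

definition ring_of_fractions :: "('a, 'm) ring_scheme \<Rightarrow> 'a set \<Rightarrow> ('a \<times> 'a) set ring" where
  "ring_of_fractions R S =
    \<lparr>carrier = {fraction R S a b | a b. a \<in> carrier R \<and> b \<in> S},
     mult = (\<lambda>U V. \<Union>x\<in>U. \<Union>y\<in>V. fraction R S (fst x \<otimes>\<^bsub>R\<^esub> fst y) (snd x \<otimes>\<^bsub>R\<^esub> snd y)),
     one = fraction R S \<one>\<^bsub>R\<^esub> \<one>\<^bsub>R\<^esub>,
     zero = fraction R S \<zero>\<^bsub>R\<^esub> \<one>\<^bsub>R\<^esub>,
     add = (\<lambda>U V. \<Union>x\<in>U. \<Union>y\<in>V.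
              fraction R S (fst x \<otimes>\<^bsub>R\<^esub> snd y \<oplus>\<^bsub>R\<^esub> fst y \<otimes>\<^bsub>R\<^esub> snd x)
                (snd x \<otimes>\<^bsub>R\<^esub> snd y))\<rparr>"


subsection \<open>Graded domains\<close>

text \<open>
  The ring \<open>R\<close> is the internal direct sum of the additive subgroups \<open>\<G> \<alpha>\<close>, for \<open>\<alpha>\<close> in the index
  set \<open>I\<close>. Values of \<open>\<G>\<close> outside \<open>I\<close> are irrelevant.
\<close>

definition internal_direct_sum :: "('a, 'm) ring_scheme \<Rightarrow> 'i set \<Rightarrow> ('i \<Rightarrow> 'a set) \<Rightarrow> bool" where
  "internal_direct_sum R I \<G> \<longleftrightarrow>
    (\<forall>\<alpha>\<in>I. additive_subgroup (\<G> \<alpha>) R) \<and>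
    (\<forall>x\<in>carrier R. \<exists>!f. f \<in> (\<Pi>\<^sub>E \<alpha>\<in>I. \<G> \<alpha>) \<and> finite {\<alpha> \<in> I. f \<alpha> \<noteq> \<zero>\<^bsub>R\<^esub>} \<and>
       x = finsum R f {\<alpha> \<in> I. f \<alpha> \<noteq> \<zero>\<^bsub>R\<^esub>})"

locale graded_domain = deg: grading_monoid \<Gamma> + domain R
  for \<Gamma> :: "('g, 'm) monoid_scheme" and R :: "('a, 'n) ring_scheme" (structure)
    and \<G> :: "'g \<Rightarrow> 'a set" +
  assumes direct_sum: "internal_direct_sum R (carrier \<Gamma>) \<G>"
    and mult_closed: "\<lbrakk>\<alpha> \<in> carrier \<Gamma>; \<beta> \<in> carrier \<Gamma>; x \<in> \<G> \<alpha>; y \<in> \<G> \<beta>\<rbrakk>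
      \<Longrightarrow> x \<otimes> y \<in> \<G> (\<alpha> \<otimes>\<^bsub>\<Gamma>\<^esub> \<beta>)"

definition homogeneous_ideal ::
    "('g, 'm) monoid_scheme \<Rightarrow> ('a, 'n) ring_scheme \<Rightarrow> ('g \<Rightarrow> 'a set) \<Rightarrow> 'a set \<Rightarrow> bool" where
  "homogeneous_ideal \<Gamma> R \<G> I \<longleftrightarrow>
    ideal I R \<and> (\<exists>S \<subseteq> (\<Union>\<alpha>\<in>carrier \<Gamma>. \<G> \<alpha>). I = genideal R S)"

definition homogeneous_prime ::
    "('g, 'm) monoid_scheme \<Rightarrow> ('a, 'n) ring_scheme \<Rightarrow> ('g \<Rightarrow> 'a set) \<Rightarrow> 'a set \<Rightarrow> bool" where
  "homogeneous_prime \<Gamma> R \<G> P \<longleftrightarrow> primeideal P R \<and> homogeneous_ideal \<Gamma> R \<G> P"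

text \<open>\<open>R\<^sub>\<alpha> / P\<^sub>\<alpha>\<close>, identified with the image of \<open>R\<^sub>\<alpha>\<close> in \<open>R Quot P\<close>.\<close>

definition quotient_grading ::
    "('a, 'n) ring_scheme \<Rightarrow> ('g \<Rightarrow> 'a set) \<Rightarrow> 'a set \<Rightarrow> 'g \<Rightarrow> 'a set set" where
  "quotient_grading R \<G> P = (\<lambda>\<alpha>. (\<lambda>x. P +>\<^bsub>R\<^esub> x) ` \<G> \<alpha>)"


subsection \<open>The homogeneous quotient field and homogeneous overrings\<close>

definition nonzero_homogeneous ::
    "('g, 'm) monoid_scheme \<Rightarrow> ('a, 'n) ring_scheme \<Rightarrow> ('g \<Rightarrow> 'a set) \<Rightarrow> 'a set" where
  "nonzero_homogeneous \<Gamma> R \<G> = (\<Union>\<alpha>\<in>carrier \<Gamma>. \<G> \<alpha> - {\<zero>\<^bsub>R\<^esub>})"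

definition homogeneous_quotient_field ::
    "('g, 'm) monoid_scheme \<Rightarrow> ('a, 'n) ring_scheme \<Rightarrow> ('g \<Rightarrow> 'a set) \<Rightarrow> ('a \<times> 'a) set ring" where
  "homogeneous_quotient_field \<Gamma> R \<G> = ring_of_fractions R (nonzero_homogeneous \<Gamma> R \<G>)"

text \<open>
  Zero is added explicitly: a degree of the quotient group that is not the degree of any fraction
  of nonzero homogeneous elements has the zero component.
\<close>

definition quotient_field_grading ::
    "('g, 'm) monoid_scheme \<Rightarrow> ('a, 'n) ring_scheme \<Rightarrow> ('g \<Rightarrow> 'a set)
      \<Rightarrow> ('g \<times> 'g) set \<Rightarrow> ('a \<times> 'a) set set" where
  "quotient_field_grading \<Gamma> R \<G> \<gamma> =
    {\<zero>\<^bsub>homogeneous_quotient_field \<Gamma> R \<G>\<^esub>} \<union>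
    {fraction R (nonzero_homogeneous \<Gamma> R \<G>) a b | a b \<alpha> \<beta>.
       \<alpha> \<in> carrier \<Gamma> \<and> \<beta> \<in> carrier \<Gamma> \<and> a \<in> \<G> \<alpha> - {\<zero>\<^bsub>R\<^esub>} \<and> b \<in> \<G> \<beta> - {\<zero>\<^bsub>R\<^esub>} \<and>
       \<gamma> = fraction \<Gamma> (carrier \<Gamma>) \<alpha> \<beta>}"

definition embed ::
    "('g, 'm) monoid_scheme \<Rightarrow> ('a, 'n) ring_scheme \<Rightarrow> ('g \<Rightarrow> 'a set) \<Rightarrow> 'a \<Rightarrow> ('a \<times> 'a) set" where
  "embed \<Gamma> R \<G> a = fraction R (nonzero_homogeneous \<Gamma> R \<G>) a \<one>\<^bsub>R\<^esub>"

abbreviation overring ::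
    "('g, 'm) monoid_scheme \<Rightarrow> ('a, 'n) ring_scheme \<Rightarrow> ('g \<Rightarrow> 'a set)
      \<Rightarrow> ('a \<times> 'a) set set \<Rightarrow> ('a \<times> 'a) set ring" where
  "overring \<Gamma> R \<G> T \<equiv> (homogeneous_quotient_field \<Gamma> R \<G>)\<lparr>carrier := T\<rparr>"

definition overring_grading ::
    "('g, 'm) monoid_scheme \<Rightarrow> ('a, 'n) ring_scheme \<Rightarrow> ('g \<Rightarrow> 'a set)
      \<Rightarrow> ('a \<times> 'a) set set \<Rightarrow> ('g \<times> 'g) set \<Rightarrow> ('a \<times> 'a) set set" where
  "overring_grading \<Gamma> R \<G> T = (\<lambda>\<gamma>. T \<inter> quotient_field_grading \<Gamma> R \<G> \<gamma>)"

definition homogeneous_overring ::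
    "('g, 'm) monoid_scheme \<Rightarrow> ('a, 'n) ring_scheme \<Rightarrow> ('g \<Rightarrow> 'a set) \<Rightarrow> ('a \<times> 'a) set set \<Rightarrow> bool"
  where
  "homogeneous_overring \<Gamma> R \<G> T \<longleftrightarrow>
    subring T (homogeneous_quotient_field \<Gamma> R \<G>) \<and> embed \<Gamma> R \<G> ` carrier R \<subseteq> T \<and>
    internal_direct_sum (overring \<Gamma> R \<G> T) (carrier (quotient_group \<Gamma>)) (overring_grading \<Gamma> R \<G> T)"


subsection \<open>Graded going-down\<close>

text \<open>\<open>Q \<inter> R\<close>, as a subset of \<open>R\<close>.\<close>

definition contraction ::
    "('g, 'm) monoid_scheme \<Rightarrow> ('a, 'n) ring_scheme \<Rightarrow> ('g \<Rightarrow> 'a set)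
      \<Rightarrow> ('a \<times> 'a) set set \<Rightarrow> 'a set" where
  "contraction \<Gamma> R \<G> Q = {a \<in> carrier R. embed \<Gamma> R \<G> a \<in> Q}"

definition gGD ::
    "('g, 'm) monoid_scheme \<Rightarrow> ('a, 'n) ring_scheme \<Rightarrow> ('g \<Rightarrow> 'a set) \<Rightarrow> ('a \<times> 'a) set set \<Rightarrow> bool"
  where
  "gGD \<Gamma> R \<G> T \<longleftrightarrow>
    (\<forall>P\<^sub>0 P Q. homogeneous_prime \<Gamma> R \<G> P\<^sub>0 \<and> homogeneous_prime \<Gamma> R \<G> P \<and> P\<^sub>0 \<subseteq> P \<and>
       homogeneous_prime (quotient_group \<Gamma>) (overring \<Gamma> R \<G> T) (overring_grading \<Gamma> R \<G> T) Q \<and>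
       contraction \<Gamma> R \<G> Q = P \<longrightarrow>
       (\<exists>Q\<^sub>0. homogeneous_prime (quotient_group \<Gamma>) (overring \<Gamma> R \<G> T) (overring_grading \<Gamma> R \<G> T) Q\<^sub>0 \<and>
          Q\<^sub>0 \<subseteq> Q \<and> contraction \<Gamma> R \<G> Q\<^sub>0 = P\<^sub>0))"

definition gGD_domain ::
    "('g, 'm) monoid_scheme \<Rightarrow> ('a, 'n) ring_scheme \<Rightarrow> ('g \<Rightarrow> 'a set) \<Rightarrow> bool" where
  "gGD_domain \<Gamma> R \<G> \<longleftrightarrow>
    graded_domain \<Gamma> R \<G> \<and> (\<forall>T. homogeneous_overring \<Gamma> R \<G> T \<longrightarrow> gGD \<Gamma> R \<G> T)"


subsection \<open>Well-definedness of the operations on fractions\<close>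

lemma UN_UN_const:
  "\<lbrakk>a \<in> A; b \<in> B; \<And>x y. x \<in> A \<Longrightarrow> y \<in> B \<Longrightarrow> F x y = K\<rbrakk> \<Longrightarrow> (\<Union>x\<in>A. \<Union>y\<in>B. F x y) = K"
  by auto

lemma (in grading_monoid) quotient_group_trans:
  assumes "a \<in> carrier \<Gamma>" "b \<in> carrier \<Gamma>" "c \<in> carrier \<Gamma>" "d \<in> carrier \<Gamma>"
    "e \<in> carrier \<Gamma>" "f \<in> carrier \<Gamma>"
    and 1: "a \<otimes> d = c \<otimes> b" and 2: "c \<otimes> f = e \<otimes> d"
  shows "a \<otimes> f = e \<otimes> b"
proof (rule cancel)
  have "(a \<otimes> f) \<otimes> d = (a \<otimes> d) \<otimes> f" using assms(1-6) by (simp add: m_ac)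
  also have "\<dots> = (c \<otimes> f) \<otimes> b" using assms(1-6) 1 by (simp add: m_ac)
  also have "\<dots> = (e \<otimes> b) \<otimes> d" using assms(1-6) 2 by (simp add: m_ac)
  finally show "(a \<otimes> f) \<otimes> d = (e \<otimes> b) \<otimes> d" .
qed (use assms in auto)

lemma (in grading_monoid) quotient_group_eq_iff:
  assumes "a \<in> carrier \<Gamma>" "b \<in> carrier \<Gamma>" "c \<in> carrier \<Gamma>" "d \<in> carrier \<Gamma>"
  shows "fraction \<Gamma> (carrier \<Gamma>) a b = fraction \<Gamma> (carrier \<Gamma>) c d \<longleftrightarrow> a \<otimes> d = c \<otimes> b"
proof
  assume "fraction \<Gamma> (carrier \<Gamma>) a b = fraction \<Gamma> (carrier \<Gamma>) c d"
  moreover have "(a, b) \<in> fraction \<Gamma> (carrier \<Gamma>) a b" using assms by (simp add: fraction_def)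
  ultimately show "a \<otimes> d = c \<otimes> b" by (auto simp: fraction_def)
next
  assume eq: "a \<otimes> d = c \<otimes> b"
  show "fraction \<Gamma> (carrier \<Gamma>) a b = fraction \<Gamma> (carrier \<Gamma>) c d"
  proof (rule Set.set_eqI, rule iffI)
    fix x assume "x \<in> fraction \<Gamma> (carrier \<Gamma>) a b"
    then obtain e f where x: "x = (e, f)" "e \<in> carrier \<Gamma>" "f \<in> carrier \<Gamma>" "a \<otimes> f = e \<otimes> b"
      unfolding fraction_def by blast
    have "c \<otimes> f = e \<otimes> d"
      by (rule quotient_group_trans[of c d a b e f]) (fact assms x eq[symmetric])+
    with x show "x \<in> fraction \<Gamma> (carrier \<Gamma>) c d" unfolding fraction_def by blast
  next
    fix x assume "x \<in> fraction \<Gamma> (carrier \<Gamma>) c d"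
    then obtain e f where x: "x = (e, f)" "e \<in> carrier \<Gamma>" "f \<in> carrier \<Gamma>" "c \<otimes> f = e \<otimes> d"
      unfolding fraction_def by blast
    have "a \<otimes> f = e \<otimes> b"
      by (rule quotient_group_trans[of a b c d e f]) (fact assms x eq)+
    with x show "x \<in> fraction \<Gamma> (carrier \<Gamma>) a b" unfolding fraction_def by blast
  qed
qed

lemma (in grading_monoid) quotient_group_mult:
  assumes abcd: "a \<in> carrier \<Gamma>" "b \<in> carrier \<Gamma>" "c \<in> carrier \<Gamma>" "d \<in> carrier \<Gamma>"
  shows "fraction \<Gamma> (carrier \<Gamma>) a b \<otimes>\<^bsub>quotient_group \<Gamma>\<^esub> fraction \<Gamma> (carrier \<Gamma>) c d
    = fraction \<Gamma> (carrier \<Gamma>) (a \<otimes> c) (b \<otimes> d)"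
proof -
  have *: "fraction \<Gamma> (carrier \<Gamma>) (a' \<otimes> c') (b' \<otimes> d') = fraction \<Gamma> (carrier \<Gamma>) (a \<otimes> c) (b \<otimes> d)"
    if "(a', b') \<in> fraction \<Gamma> (carrier \<Gamma>) a b" "(c', d') \<in> fraction \<Gamma> (carrier \<Gamma>) c d"
    for a' b' c' d'
  proof -
    have c': "a' \<in> carrier \<Gamma>" "b' \<in> carrier \<Gamma>" "c' \<in> carrier \<Gamma>" "d' \<in> carrier \<Gamma>"
      and e: "a \<otimes> b' = a' \<otimes> b" "c \<otimes> d' = c' \<otimes> d"
      using that by (auto simp: fraction_def)
    have "(a' \<otimes> c') \<otimes> (b \<otimes> d) = (a' \<otimes> b) \<otimes> (c' \<otimes> d)" using abcd c' by (simp add: m_ac)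
    also have "\<dots> = (a \<otimes> b') \<otimes> (c \<otimes> d')" using e by simp
    also have "\<dots> = (a \<otimes> c) \<otimes> (b' \<otimes> d')" using abcd c' by (simp add: m_ac)
    finally show ?thesis using abcd c' by (subst quotient_group_eq_iff) auto
  qed
  have "(a, b) \<in> fraction \<Gamma> (carrier \<Gamma>) a b" "(c, d) \<in> fraction \<Gamma> (carrier \<Gamma>) c d"
    using abcd by (simp_all add: fraction_def)
  then have "(\<Union>x\<in>fraction \<Gamma> (carrier \<Gamma>) a b. \<Union>y\<in>fraction \<Gamma> (carrier \<Gamma>) c d.
      fraction \<Gamma> (carrier \<Gamma>) (fst x \<otimes> fst y) (snd x \<otimes> snd y))
    = fraction \<Gamma> (carrier \<Gamma>) (a \<otimes> c) (b \<otimes> d)"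
    by (rule UN_UN_const) (simp add: *)
  then show ?thesis by (simp add: quotient_group_def)
qed

lemma (in domain) fraction_trans:
  assumes "a \<in> carrier R" "b \<in> carrier R" "c \<in> carrier R" "d \<in> carrier R" "d \<noteq> \<zero>"
    "e \<in> carrier R" "f \<in> carrier R"
    and 1: "a \<otimes> d = c \<otimes> b" and 2: "c \<otimes> f = e \<otimes> d"
  shows "a \<otimes> f = e \<otimes> b"
proof -
  have "d \<otimes> (a \<otimes> f) = (a \<otimes> d) \<otimes> f" using assms(1-7) by (simp add: m_ac)
  also have "\<dots> = (c \<otimes> f) \<otimes> b" using assms(1-7) 1 by (simp add: m_ac)
  also have "\<dots> = d \<otimes> (e \<otimes> b)" using assms(1-7) 2 by (simp add: m_ac)
  finally show ?thesis using assms(1-7) m_lcancel[of d "a \<otimes> f" "e \<otimes> b"] by simp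
qed

lemma (in domain) fraction_eq_iff:
  assumes S: "S \<subseteq> carrier R - {\<zero>}"
    and abcd: "a \<in> carrier R" "b \<in> S" "c \<in> carrier R" "d \<in> S"
  shows "fraction R S a b = fraction R S c d \<longleftrightarrow> a \<otimes> d = c \<otimes> b"
proof
  assume "fraction R S a b = fraction R S c d"
  moreover have "(a, b) \<in> fraction R S a b" using abcd by (simp add: fraction_def)
  ultimately show "a \<otimes> d = c \<otimes> b" by (auto simp: fraction_def)
next
  assume eq: "a \<otimes> d = c \<otimes> b"
  have cS: "b \<in> carrier R" "b \<noteq> \<zero>" "d \<in> carrier R" "d \<noteq> \<zero>" using S abcd by blast+
  show "fraction R S a b = fraction R S c d"
  proof (rule Set.set_eqI, rule iffI)
    fix x assume "x \<in> fraction R S a b"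
    then obtain e f where x: "x = (e, f)" "e \<in> carrier R" "f \<in> S" "a \<otimes> f = e \<otimes> b"
      unfolding fraction_def by blast
    have f: "f \<in> carrier R" using S x by blast
    have "c \<otimes> f = e \<otimes> d"
      by (rule fraction_trans[of c d a b e f]) (fact abcd cS x f eq[symmetric])+
    with x show "x \<in> fraction R S c d" unfolding fraction_def by blast
  next
    fix x assume "x \<in> fraction R S c d"
    then obtain e f where x: "x = (e, f)" "e \<in> carrier R" "f \<in> S" "c \<otimes> f = e \<otimes> d"
      unfolding fraction_def by blast
    have f: "f \<in> carrier R" using S x by blast
    have "a \<otimes> f = e \<otimes> b"
      by (rule fraction_trans[of a b c d e f]) (fact abcd cS x f eq)+
    with x show "x \<in> fraction R S a b" unfolding fraction_def by blast
  qed
qed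

lemma (in domain) fraction_mult:
  assumes S: "S \<subseteq> carrier R - {\<zero>}" "\<And>s t. s \<in> S \<Longrightarrow> t \<in> S \<Longrightarrow> s \<otimes> t \<in> S"
    and abcd: "a \<in> carrier R" "b \<in> S" "c \<in> carrier R" "d \<in> S"
  shows "fraction R S a b \<otimes>\<^bsub>ring_of_fractions R S\<^esub> fraction R S c d
    = fraction R S (a \<otimes> c) (b \<otimes> d)"
proof -
  have *: "fraction R S (a' \<otimes> c') (b' \<otimes> d') = fraction R S (a \<otimes> c) (b \<otimes> d)"
    if "(a', b') \<in> fraction R S a b" "(c', d') \<in> fraction R S c d" for a' b' c' d'
  proof -
    have c': "a' \<in> carrier R" "b' \<in> S" "c' \<in> carrier R" "d' \<in> S"
      and e: "a \<otimes> b' = a' \<otimes> b" "c \<otimes> d' = c' \<otimes> d"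
      using that by (auto simp: fraction_def)
    have cS: "b \<in> carrier R" "d \<in> carrier R" "b' \<in> carrier R" "d' \<in> carrier R"
      using S abcd c' by auto
    have "(a' \<otimes> c') \<otimes> (b \<otimes> d) = (a' \<otimes> b) \<otimes> (c' \<otimes> d)"
      using abcd c' cS by (simp add: m_ac)
    also have "\<dots> = (a \<otimes> b') \<otimes> (c \<otimes> d')" using e by simp
    also have "\<dots> = (a \<otimes> c) \<otimes> (b' \<otimes> d')" using abcd c' cS by (simp add: m_ac)
    finally show ?thesis using S abcd c' by (subst fraction_eq_iff) auto
  qed
  have "(a, b) \<in> fraction R S a b" "(c, d) \<in> fraction R S c d"
    using abcd by (simp_all add: fraction_def)
  then have "(\<Union>x\<in>fraction R S a b. \<Union>y\<in>fraction R S c d.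
      fraction R S (fst x \<otimes> fst y) (snd x \<otimes> snd y))
    = fraction R S (a \<otimes> c) (b \<otimes> d)"
    by (rule UN_UN_const) (simp add: *)
  then show ?thesis by (simp add: ring_of_fractions_def)
qed

lemma (in domain) fraction_add:
  assumes S: "S \<subseteq> carrier R - {\<zero>}" "\<And>s t. s \<in> S \<Longrightarrow> t \<in> S \<Longrightarrow> s \<otimes> t \<in> S"
    and abcd: "a \<in> carrier R" "b \<in> S" "c \<in> carrier R" "d \<in> S"
  shows "fraction R S a b \<oplus>\<^bsub>ring_of_fractions R S\<^esub> fraction R S c d
    = fraction R S (a \<otimes> d \<oplus> c \<otimes> b) (b \<otimes> d)"
proof -
  have *: "fraction R S (a' \<otimes> d' \<oplus> c' \<otimes> b') (b' \<otimes> d') = fraction R S (a \<otimes> d \<oplus> c \<otimes> b) (b \<otimes> d)"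
    if "(a', b') \<in> fraction R S a b" "(c', d') \<in> fraction R S c d" for a' b' c' d'
  proof -
    have c': "a' \<in> carrier R" "b' \<in> S" "c' \<in> carrier R" "d' \<in> S"
      and e: "a \<otimes> b' = a' \<otimes> b" "c \<otimes> d' = c' \<otimes> d"
      using that by (auto simp: fraction_def)
    have cS: "b \<in> carrier R" "d \<in> carrier R" "b' \<in> carrier R" "d' \<in> carrier R"
      using S abcd c' by auto
    have "(a' \<otimes> d' \<oplus> c' \<otimes> b') \<otimes> (b \<otimes> d) = (a' \<otimes> b) \<otimes> (d \<otimes> d') \<oplus> (c' \<otimes> d) \<otimes> (b \<otimes> b')"
      using abcd c' cS by (simp add: m_ac l_distr r_distr)
    also have "\<dots> = (a \<otimes> b') \<otimes> (d \<otimes> d') \<oplus> (c \<otimes> d') \<otimes> (b \<otimes> b')" using e by simp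
    also have "\<dots> = (a \<otimes> d \<oplus> c \<otimes> b) \<otimes> (b' \<otimes> d')"
      using abcd c' cS by (simp add: m_ac l_distr r_distr)
    finally show ?thesis using S abcd c' cS by (subst fraction_eq_iff) auto
  qed
  have "(a, b) \<in> fraction R S a b" "(c, d) \<in> fraction R S c d"
    using abcd by (simp_all add: fraction_def)
  then have "(\<Union>x\<in>fraction R S a b. \<Union>y\<in>fraction R S c d.
      fraction R S (fst x \<otimes> snd y \<oplus> fst y \<otimes> snd x) (snd x \<otimes> snd y))
    = fraction R S (a \<otimes> d \<oplus> c \<otimes> b) (b \<otimes> d)"
    by (rule UN_UN_const) (simp add: *)
  then show ?thesis by (simp add: ring_of_fractions_def)
qed

end

theory Submission
  imports Defs
begin

text \<open>
  Let \<open>T\<close> be a homogeneous overring of \<open>R/P\<close>. The localization of \<open>R\<close> at its homogeneous elements outside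
  \<open>P\<close> is a subring of the homogeneous quotient field of \<open>R\<close>, and it maps onto the homogeneous quotient
  field of \<open>R/P\<close> by reducing numerators and denominators modulo \<open>P\<close> (\<open>reduce\<close>, \<open>reduce_surj\<close>). The preimage
  of \<open>T\<close> under this map is a homogeneous overring \<open>T'\<close> of \<open>R\<close> (\<open>pullback_overring\<close>), and \<open>T\<close> is the
  quotient of \<open>T'\<close> by the kernel \<open>M\<close>, a prime ideal that contracts to \<open>P\<close>.

  A going-down problem for \<open>R/P \<subseteq> T\<close> pulls back to one for \<open>R \<subseteq> T'\<close>, which has a solution \<open>Q\<^sub>0\<close> because \<open>R\<close>
  is a gGD domain. To push \<open>Q\<^sub>0\<close> down to \<open>T\<close>, one needs \<open>M \<subseteq> Q\<^sub>0\<close>. This holds unless \<open>Q\<^sub>0 \<subseteq> M\<close>: a homogeneous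
  element of \<open>Q\<^sub>0\<close> outside \<open>M\<close> is invertible in the localization, and multiplying elements of \<open>M\<close> by its
  inverse does not leave \<open>M\<close>, so all of \<open>M\<close> consists of multiples of that element
  (\<open>kernel_subset_prime\<close>). If \<open>Q\<^sub>0 \<subseteq> M\<close>, then the prime of \<open>R/P\<close> to be lifted is zero, and the zero ideal
  of \<open>T\<close> is a solution (\<open>gGD_reduce\<close>).

  The gradings enter through the projections onto homogeneous components. Homogeneous ideals and
  homogeneous overrings are those closed under these projections (\<open>homogeneous_ideal_iff\<close>,
  \<open>homogeneous_overring_iff\<close>), and reduction modulo \<open>P\<close> commutes with them
  (\<open>localization_component\<close>). For this, \<open>R/P\<close> and the homogeneous quotient field have to be
  recognised as direct sums of their components (\<open>graded_domain_Quot\<close>, \<open>RH_direct_sum\<close>).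
\<close>

section \<open>Direct sums of additive subgroups\<close>

text \<open>
  A graded additive subgroup is one that is closed under the projections onto the homogeneous
  components. Expressing everything through these projections leaves finite sums only to the proofs
  in this section.
\<close>

locale direct_sum_decomposition = abelian_group R
  for R :: "('a, 'n) ring_scheme" (structure) and I :: "'i set" and \<G> :: "'i \<Rightarrow> 'a set" +
  assumes decomposition: "internal_direct_sum R I \<G>"
begin

definition component :: "'i \<Rightarrow> 'a \<Rightarrow> 'a" where
  "component \<alpha> x = (THE f. f \<in> (\<Pi>\<^sub>E \<beta>\<in>I. \<G> \<beta>) \<and> finite {\<beta> \<in> I. f \<beta> \<noteq> \<zero>} \<and>
     x = finsum R f {\<beta> \<in> I. f \<beta> \<noteq> \<zero>}) \<alpha>"

abbreviation degrees :: "'a \<Rightarrow> 'i set" where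
  "degrees x \<equiv> {\<alpha> \<in> I. component \<alpha> x \<noteq> \<zero>}"

lemma subgroup: "\<alpha> \<in> I \<Longrightarrow> additive_subgroup (\<G> \<alpha>) R"
  using decomposition by (simp add: internal_direct_sum_def)

lemma in_carrier: "\<alpha> \<in> I \<Longrightarrow> x \<in> \<G> \<alpha> \<Longrightarrow> x \<in> carrier R"
  using additive_subgroup.a_subset[OF subgroup] by blast

lemma zero_in: "\<alpha> \<in> I \<Longrightarrow> \<zero> \<in> \<G> \<alpha>"
  by (rule additive_subgroup.zero_closed[OF subgroup])

lemma component_spec:
  assumes "x \<in> carrier R"
  shows "(\<lambda>\<alpha>. component \<alpha> x) \<in> (\<Pi>\<^sub>E \<alpha>\<in>I. \<G> \<alpha>) \<and> finite (degrees x) \<and>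
    x = (\<Oplus>\<alpha>\<in>degrees x. component \<alpha> x)"
proof -
  have "\<exists>!f. f \<in> (\<Pi>\<^sub>E \<beta>\<in>I. \<G> \<beta>) \<and> finite {\<beta> \<in> I. f \<beta> \<noteq> \<zero>} \<and>
      x = finsum R f {\<beta> \<in> I. f \<beta> \<noteq> \<zero>}"
    using decomposition assms by (simp add: internal_direct_sum_def)
  from theI'[OF this] show ?thesis unfolding component_def by simp
qed

lemma component_in: "x \<in> carrier R \<Longrightarrow> \<alpha> \<in> I \<Longrightarrow> component \<alpha> x \<in> \<G> \<alpha>"
  using component_spec by (auto simp: PiE_iff)

lemma component_closed: "x \<in> carrier R \<Longrightarrow> \<alpha> \<in> I \<Longrightarrow> component \<alpha> x \<in> carrier R"
  using component_in in_carrier by blast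

lemma finite_degrees: "x \<in> carrier R \<Longrightarrow> finite (degrees x)"
  using component_spec by blast

lemma sum_components: "x \<in> carrier R \<Longrightarrow> (\<Oplus>\<alpha>\<in>degrees x. component \<alpha> x) = x"
  using component_spec by simp

lemma sum_components_superset:
  assumes "x \<in> carrier R" "finite F" "F \<subseteq> I" "degrees x \<subseteq> F"
  shows "(\<Oplus>\<alpha>\<in>F. component \<alpha> x) = x"
proof -
  have "(\<Oplus>\<alpha>\<in>F. component \<alpha> x) = (\<Oplus>\<alpha>\<in>degrees x. component \<alpha> x)"
    by (rule add.finprod_mono_neutral_cong_right) (use assms component_closed in auto)
  then show ?thesis using sum_components assms by simp
qed

lemma component_sum:
  assumes F: "finite F" "F \<subseteq> I" and g: "\<And>\<beta>. \<beta> \<in> F \<Longrightarrow> g \<beta> \<in> \<G> \<beta>" and \<alpha>: "\<alpha> \<in> I"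
  shows "component \<alpha> (finsum R g F) = (if \<alpha> \<in> F then g \<alpha> else \<zero>)"
proof -
  define f where "f = (\<lambda>\<beta>\<in>I. if \<beta> \<in> F then g \<beta> else \<zero>)"
  let ?x = "finsum R g F"
  have carr: "g \<in> F \<rightarrow> carrier R" using F g in_carrier by blast
  have f: "f \<in> (\<Pi>\<^sub>E \<beta>\<in>I. \<G> \<beta>)" using g zero_in by (auto simp: f_def)
  have supp: "{\<beta> \<in> I. f \<beta> \<noteq> \<zero>} \<subseteq> F" by (auto simp: f_def)
  have "?x = finsum R f {\<beta> \<in> I. f \<beta> \<noteq> \<zero>}"
    by (rule add.finprod_mono_neutral_cong_right) (use F carr supp in \<open>auto simp: f_def\<close>)
  moreover have "finite {\<beta> \<in> I. f \<beta> \<noteq> \<zero>}" using supp F(1) by (rule finite_subset)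
  moreover have "\<exists>!f. f \<in> (\<Pi>\<^sub>E \<beta>\<in>I. \<G> \<beta>) \<and> finite {\<beta> \<in> I. f \<beta> \<noteq> \<zero>} \<and>
      ?x = finsum R f {\<beta> \<in> I. f \<beta> \<noteq> \<zero>}"
    using decomposition carr by (simp add: internal_direct_sum_def)
  ultimately have "(THE f. f \<in> (\<Pi>\<^sub>E \<beta>\<in>I. \<G> \<beta>) \<and> finite {\<beta> \<in> I. f \<beta> \<noteq> \<zero>} \<and>
      ?x = finsum R f {\<beta> \<in> I. f \<beta> \<noteq> \<zero>}) = f"
    using f by (intro the1_equality) auto
  then show ?thesis using \<alpha> by (simp add: component_def f_def)
qed

lemma component_homogeneous:
  assumes "\<alpha> \<in> I" "\<beta> \<in> I" "x \<in> \<G> \<beta>"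
  shows "component \<alpha> x = (if \<alpha> = \<beta> then x else \<zero>)"
proof -
  have "finsum R (\<lambda>_. x) {\<beta>} = x" using assms in_carrier by simp
  then show ?thesis using component_sum[of "{\<beta>}" "\<lambda>_. x" \<alpha>] assms by simp
qed

lemma component_zero: "\<alpha> \<in> I \<Longrightarrow> component \<alpha> \<zero> = \<zero>"
  using component_homogeneous[of \<alpha> \<alpha> \<zero>] zero_in by simp

lemma component_add:
  assumes "x \<in> carrier R" "y \<in> carrier R" "\<alpha> \<in> I"
  shows "component \<alpha> (x \<oplus> y) = component \<alpha> x \<oplus> component \<alpha> y"
proof -
  define F where "F = insert \<alpha> (degrees x \<union> degrees y)"
  have F: "finite F" "F \<subseteq> I" "degrees x \<subseteq> F" "degrees y \<subseteq> F"
    using assms finite_degrees by (auto simp: F_def)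
  have "x \<oplus> y = (\<Oplus>\<beta>\<in>F. component \<beta> x) \<oplus> (\<Oplus>\<beta>\<in>F. component \<beta> y)"
    using F assms by (simp add: sum_components_superset)
  also have "\<dots> = (\<Oplus>\<beta>\<in>F. component \<beta> x \<oplus> component \<beta> y)"
    using F component_closed assms by (subst finsum_addf) auto
  finally have "component \<alpha> (x \<oplus> y) =
      component \<alpha> (\<Oplus>\<beta>\<in>F. component \<beta> x \<oplus> component \<beta> y)" by simp
  also have "\<dots> = component \<alpha> x \<oplus> component \<alpha> y"
    using F assms component_in additive_subgroup.a_closed[OF subgroup]
    by (subst component_sum) (auto simp: F_def)
  finally show ?thesis .
qed

text \<open>
  As each element is the sum of its components, a property that passes to sums needs to be checked
  on the components of the element at hand only, not on all homogeneous elements.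
\<close>

lemma component_induct [consumes 1, case_names component zero add]:
  assumes x: "x \<in> carrier R"
    and comp: "\<And>\<alpha>. \<alpha> \<in> I \<Longrightarrow> pr (component \<alpha> x)" and zero: "pr \<zero>"
    and add: "\<And>y z. \<lbrakk>y \<in> carrier R; z \<in> carrier R; pr y; pr z\<rbrakk> \<Longrightarrow> pr (y \<oplus> z)"
  shows "pr x"
proof -
  have "F \<subseteq> I \<Longrightarrow> pr (\<Oplus>\<alpha>\<in>F. component \<alpha> x)" if "finite F" for F
    using that
  proof (induction F)
    case (insert \<alpha> F)
    then have "(\<lambda>\<alpha>. component \<alpha> x) \<in> F \<rightarrow> carrier R" "component \<alpha> x \<in> carrier R"
      using x component_closed by auto
    with insert show ?case by (simp add: add comp)
  qed (simp add: zero)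
  from this[OF finite_degrees[OF x]] show ?thesis using x by (simp add: sum_components)
qed

text \<open>
  Both sides are additive in \<open>x\<close>, and they agree on homogeneous elements. The
  projection modulo a homogeneous prime and the inclusion of an overring are instances.
\<close>

lemma homogeneous_map_component:
  assumes "direct_sum_decomposition S I \<H>"
    and h: "\<And>x. x \<in> carrier R \<Longrightarrow> h x \<in> carrier S"
      "\<And>x y. x \<in> carrier R \<Longrightarrow> y \<in> carrier R \<Longrightarrow> h (x \<oplus> y) = h x \<oplus>\<^bsub>S\<^esub> h y"
      "\<And>\<alpha> x. \<alpha> \<in> I \<Longrightarrow> x \<in> \<G> \<alpha> \<Longrightarrow> h x \<in> \<H> \<alpha>"
    and x: "x \<in> carrier R" and \<alpha>: "\<alpha> \<in> I"
  shows "h (component \<alpha> x) = direct_sum_decomposition.component S I \<H> \<alpha> (h x)"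
proof -
  interpret S: direct_sum_decomposition S I \<H> by fact
  have h0: "h \<zero> = \<zero>\<^bsub>S\<^esub>"
  proof -
    have "h \<zero> \<oplus>\<^bsub>S\<^esub> h \<zero> = h \<zero>" using h(2)[of \<zero> \<zero>] by simp
    then show ?thesis using h(1)[OF zero_closed] S.r_neg1[of "h \<zero>" "h \<zero>"] by (simp add: S.l_neg)
  qed
  from x show ?thesis
  proof (induction rule: component_induct)
    case (component \<beta>)
    then show ?case
      using x \<alpha> h(3)[of \<beta> "component \<beta> x"] component_in[of x \<beta>] h0
      by (simp add: component_homogeneous[of \<alpha> \<beta>] S.component_homogeneous[of \<alpha> \<beta>])
  next
    case zero
    then show ?case using \<alpha> by (simp add: component_zero h0 S.component_zero)
  next
    case (add y z)
    then show ?case using \<alpha> h(1,2) by (simp add: component_add S.component_add component_closed)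
  qed
qed

end

text \<open>
  A criterion in which neither generation nor independence mentions finite sums. For uniqueness,
  subtract two decompositions of an element: the difference of their terms of degree \<open>\<alpha>\<close> is a sum of
  elements of other degrees, so it lies in \<open>\<G> \<alpha>\<close> and in the subgroup \<open>B\<close> belonging to \<open>\<alpha>\<close>. In the
  applications \<open>B\<close> is the kernel of the projection onto degree \<open>\<alpha>\<close>, which need not be constructed.
\<close>

lemma internal_direct_sumI:
  fixes R (structure)
  assumes "abelian_group R"
    and sub: "\<And>\<alpha>. \<alpha> \<in> I \<Longrightarrow> additive_subgroup (\<G> \<alpha>) R"
    and gen: "\<And>x B. \<lbrakk>x \<in> carrier R; additive_subgroup B R; \<And>\<alpha>. \<alpha> \<in> I \<Longrightarrow> \<G> \<alpha> \<subseteq> B\<rbrakk> \<Longrightarrow> x \<in> B"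
    and ind: "\<And>\<alpha>. \<alpha> \<in> I \<Longrightarrow>
      \<exists>B. additive_subgroup B R \<and> (\<forall>\<beta>\<in>I - {\<alpha>}. \<G> \<beta> \<subseteq> B) \<and> \<G> \<alpha> \<inter> B \<subseteq> {\<zero>}"
  shows "internal_direct_sum R I \<G>"
proof -
  interpret abelian_group R by fact
  have carr: "x \<in> carrier R" if "\<alpha> \<in> I" "x \<in> \<G> \<alpha>" for \<alpha> x
    using that additive_subgroup.a_subset[OF sub] by blast
  have z: "\<zero> \<in> \<G> \<alpha>" if "\<alpha> \<in> I" for \<alpha>
    using that by (rule additive_subgroup.zero_closed[OF sub])
  have sum_in: "finsum R f F \<in> B"
    if "finite F" "additive_subgroup B R" "\<And>\<alpha>. \<alpha> \<in> F \<Longrightarrow> f \<alpha> \<in> B" for F B and f :: "_ \<Rightarrow> 'a"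
    using that
  proof (induction F)
    case empty
    then show ?case by (simp add: additive_subgroup.zero_closed)
  next
    case (insert \<alpha> F)
    then have "f \<in> F \<rightarrow> carrier R" "f \<alpha> \<in> carrier R"
      using additive_subgroup.a_subset by blast+
    with insert show ?case by (simp add: additive_subgroup.a_closed)
  qed
  define Sums where "Sums = {finsum R f F | f F. finite F \<and> F \<subseteq> I \<and> (\<forall>\<alpha>\<in>F. f \<alpha> \<in> \<G> \<alpha>)}"
  have "additive_subgroup Sums R"
  proof (rule additive_subgroupI, rule add.subgroupI)
    show "Sums \<subseteq> carrier R"
      using carr by (auto simp: Sums_def intro!: finsum_closed)
    have "finsum R (\<lambda>_. \<zero>) {} \<in> Sums"
      unfolding Sums_def by (intro CollectI exI[of _ "{}"] exI[of _ "\<lambda>_. \<zero>"]) simp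
    then show "Sums \<noteq> {}" by blast
  next
    fix x assume "x \<in> Sums"
    then obtain f F where f: "finite F" "F \<subseteq> I" "\<And>\<alpha>. \<alpha> \<in> F \<Longrightarrow> f \<alpha> \<in> \<G> \<alpha>" "x = finsum R f F"
      by (auto simp: Sums_def)
    have c: "f \<in> F \<rightarrow> carrier R" using f carr by blast
    have "\<ominus> x = (\<Oplus>\<alpha>\<in>F. \<ominus> f \<alpha>)"
    proof -
      have "x \<oplus> (\<Oplus>\<alpha>\<in>F. \<ominus> f \<alpha>) = (\<Oplus>\<alpha>\<in>F. f \<alpha> \<oplus> \<ominus> f \<alpha>)"
        unfolding f(4) using c by (subst finsum_addf) auto
      also have "\<dots> = \<zero>"
        using c by (intro add.finprod_one_eqI) (auto simp: r_neg Pi_iff)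
      finally have "(\<Oplus>\<alpha>\<in>F. \<ominus> f \<alpha>) \<oplus> x = \<zero>" using c f(4) by (simp add: a_comm Pi_iff)
      then show ?thesis using c f(4) by (intro minus_equality) (auto simp: Pi_iff)
    qed
    moreover have "\<ominus> f \<alpha> \<in> \<G> \<alpha>" if "\<alpha> \<in> F" for \<alpha>
      using that f additive_subgroup.a_inv_closed[OF sub] by blast
    ultimately show "\<ominus> x \<in> Sums" unfolding Sums_def using f by blast
  next
    fix x y assume "x \<in> Sums" "y \<in> Sums"
    from \<open>x \<in> Sums\<close> obtain f F where
      f: "finite F" "F \<subseteq> I" "\<And>\<alpha>. \<alpha> \<in> F \<Longrightarrow> f \<alpha> \<in> \<G> \<alpha>" "x = finsum R f F"
      by (auto simp: Sums_def)
    from \<open>y \<in> Sums\<close> obtain g H where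
      g: "finite H" "H \<subseteq> I" "\<And>\<alpha>. \<alpha> \<in> H \<Longrightarrow> g \<alpha> \<in> \<G> \<alpha>" "y = finsum R g H"
      by (auto simp: Sums_def)
    \<comment> \<open>Extended by zero, both sums run over the same index set.\<close>
    define f' where "f' \<alpha> = (if \<alpha> \<in> F then f \<alpha> else \<zero>)" for \<alpha>
    define g' where "g' \<alpha> = (if \<alpha> \<in> H then g \<alpha> else \<zero>)" for \<alpha>
    have c: "f' \<alpha> \<in> \<G> \<alpha>" "g' \<alpha> \<in> \<G> \<alpha>" if "\<alpha> \<in> F \<union> H" for \<alpha>
      using that f g z by (auto simp: f'_def g'_def)
    have c': "f' \<in> F \<union> H \<rightarrow> carrier R" "g' \<in> F \<union> H \<rightarrow> carrier R"
      using c carr f(2) g(2) by blast+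
    have "x = finsum R f' (F \<union> H)" unfolding f(4)
      by (rule add.finprod_mono_neutral_cong) (use f g c' carr in \<open>auto simp: f'_def\<close>)
    moreover have "y = finsum R g' (F \<union> H)" unfolding g(4)
      by (rule add.finprod_mono_neutral_cong) (use f g c' carr in \<open>auto simp: g'_def\<close>)
    ultimately have "x \<oplus> y = (\<Oplus>\<alpha>\<in>F \<union> H. f' \<alpha> \<oplus> g' \<alpha>)" using c' by (simp add: finsum_addf)
    moreover have "f' \<alpha> \<oplus> g' \<alpha> \<in> \<G> \<alpha>" if "\<alpha> \<in> F \<union> H" for \<alpha>
      using c[OF that] that f(2) g(2) additive_subgroup.a_closed[OF sub] by blast
    ultimately show "x \<oplus> y \<in> Sums" unfolding Sums_def using f g by blast
  qed
  moreover have "\<G> \<alpha> \<subseteq> Sums" if "\<alpha> \<in> I" for \<alpha>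
  proof
    fix x assume x: "x \<in> \<G> \<alpha>"
    then have "x = finsum R (\<lambda>_. x) {\<alpha>}" using that carr by simp
    then show "x \<in> Sums" using x that unfolding Sums_def by blast
  qed
  ultimately have all: "x \<in> Sums" if "x \<in> carrier R" for x using gen that by blast
  have ex: "\<exists>f. f \<in> (\<Pi>\<^sub>E \<alpha>\<in>I. \<G> \<alpha>) \<and> finite {\<alpha> \<in> I. f \<alpha> \<noteq> \<zero>} \<and>
      x = finsum R f {\<alpha> \<in> I. f \<alpha> \<noteq> \<zero>}" if "x \<in> carrier R" for x
  proof -
    obtain g F where g: "finite F" "F \<subseteq> I" "\<And>\<alpha>. \<alpha> \<in> F \<Longrightarrow> g \<alpha> \<in> \<G> \<alpha>" "x = finsum R g F"
      using all[OF \<open>x \<in> carrier R\<close>] by (auto simp: Sums_def)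
    define f where "f = (\<lambda>\<alpha>\<in>I. if \<alpha> \<in> F then g \<alpha> else \<zero>)"
    have supp: "{\<alpha> \<in> I. f \<alpha> \<noteq> \<zero>} \<subseteq> F" by (auto simp: f_def)
    have "x = finsum R f {\<alpha> \<in> I. f \<alpha> \<noteq> \<zero>}" unfolding g(4)
      by (rule add.finprod_mono_neutral_cong_right) (use g carr supp in \<open>auto simp: f_def\<close>)
    moreover have "f \<in> (\<Pi>\<^sub>E \<alpha>\<in>I. \<G> \<alpha>)" using g z by (auto simp: f_def)
    ultimately show ?thesis using finite_subset[OF supp g(1)] by blast
  qed
  have uniq: "f = g"
    if f: "f \<in> (\<Pi>\<^sub>E \<alpha>\<in>I. \<G> \<alpha>)" "finite {\<alpha> \<in> I. f \<alpha> \<noteq> \<zero>}"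
      and g: "g \<in> (\<Pi>\<^sub>E \<alpha>\<in>I. \<G> \<alpha>)" "finite {\<alpha> \<in> I. g \<alpha> \<noteq> \<zero>}"
      and eq: "finsum R f {\<alpha> \<in> I. f \<alpha> \<noteq> \<zero>} = finsum R g {\<alpha> \<in> I. g \<alpha> \<noteq> \<zero>}"
    for f g
  proof (rule PiE_ext[OF f(1) g(1)])
    fix \<alpha> assume \<alpha>: "\<alpha> \<in> I"
    define F where "F = {\<beta> \<in> I. f \<beta> \<noteq> \<zero>} \<union> {\<beta> \<in> I. g \<beta> \<noteq> \<zero>} - {\<alpha>}"
    have F: "finite F" "F \<subseteq> I - {\<alpha>}" using f g by (auto simp: F_def)
    have c: "f \<beta> \<in> \<G> \<beta>" "g \<beta> \<in> \<G> \<beta>" "f \<beta> \<in> carrier R" "g \<beta> \<in> carrier R" if "\<beta> \<in> I" for \<beta>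
      using that f g carr by (auto simp: PiE_iff)
    obtain B where B: "additive_subgroup B R" "\<And>\<beta>. \<beta> \<in> I - {\<alpha>} \<Longrightarrow> \<G> \<beta> \<subseteq> B" "\<G> \<alpha> \<inter> B \<subseteq> {\<zero>}"
      using ind[OF \<alpha>] by blast
    have "f \<beta> \<in> B" "g \<beta> \<in> B" if "\<beta> \<in> F" for \<beta>
      using that F B(2)[of \<beta>] c[of \<beta>] by blast+
    then have fin: "finsum R f F \<in> B" "finsum R g F \<in> B"
      using F(1) B(1) by (simp_all add: sum_in)
    have finc: "finsum R f F \<in> carrier R" "finsum R g F \<in> carrier R"
      using fin additive_subgroup.a_subset[OF B(1)] by blast+
    have "finsum R f (insert \<alpha> F) = finsum R f {\<alpha> \<in> I. f \<alpha> \<noteq> \<zero>}"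
      by (rule add.finprod_mono_neutral_cong_right) (use F c \<alpha> in \<open>auto simp: F_def\<close>)
    moreover have "finsum R g (insert \<alpha> F) = finsum R g {\<alpha> \<in> I. g \<alpha> \<noteq> \<zero>}"
      by (rule add.finprod_mono_neutral_cong_right) (use F c \<alpha> in \<open>auto simp: F_def\<close>)
    moreover have "finsum R f (insert \<alpha> F) = f \<alpha> \<oplus> finsum R f F"
      "finsum R g (insert \<alpha> F) = g \<alpha> \<oplus> finsum R g F"
      using F c \<alpha> by (auto intro!: finsum_insert)
    ultimately have e: "f \<alpha> \<oplus> finsum R f F = g \<alpha> \<oplus> finsum R g F" using eq by simp
    have "f \<alpha> \<ominus> g \<alpha> = finsum R g F \<ominus> finsum R f F"
    proof -
      have "f \<alpha> \<ominus> g \<alpha> = (f \<alpha> \<oplus> finsum R f F) \<oplus> \<ominus> finsum R f F \<ominus> g \<alpha>"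
        using c[OF \<alpha>] finc by (simp add: a_assoc r_neg)
      also have "\<dots> = (g \<alpha> \<ominus> g \<alpha>) \<oplus> (finsum R g F \<ominus> finsum R f F)"
        unfolding e using c[OF \<alpha>] finc by (simp add: minus_eq a_ac)
      finally show ?thesis using c[OF \<alpha>] finc by (simp add: minus_eq r_neg)
    qed
    moreover have "finsum R g F \<ominus> finsum R f F \<in> B"
      using fin B(1) additive_subgroup.a_closed additive_subgroup.a_inv_closed
      by (metis minus_eq)
    moreover have "f \<alpha> \<ominus> g \<alpha> \<in> \<G> \<alpha>"
      using c[OF \<alpha>] sub[OF \<alpha>] additive_subgroup.a_closed additive_subgroup.a_inv_closed
      by (metis minus_eq)
    ultimately have "f \<alpha> \<ominus> g \<alpha> = \<zero>" using B(3) by auto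
    then show "f \<alpha> = g \<alpha>"
      using c[OF \<alpha>] by (metis a_inv_closed add.inv_inv minus_eq minus_equality)
  qed
  show ?thesis unfolding internal_direct_sum_def
  proof (intro conjI ballI)
    fix x assume x: "x \<in> carrier R"
    show "\<exists>!f. f \<in> (\<Pi>\<^sub>E \<alpha>\<in>I. \<G> \<alpha>) \<and> finite {\<alpha> \<in> I. f \<alpha> \<noteq> \<zero>} \<and>
        x = finsum R f {\<alpha> \<in> I. f \<alpha> \<noteq> \<zero>}"
      using ex[OF x] uniq by (intro ex_ex1I) auto
  qed (rule sub)
qed

lemma additive_subgroup_restrict:
  assumes "abelian_group R" "additive_subgroup A R" "additive_subgroup B R" "A \<subseteq> B"
  shows "additive_subgroup A (R\<lparr>carrier := B\<rparr>)"
proof -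
  interpret abelian_group R by fact
  have "subgroup A (add_monoid R\<lparr>carrier := B\<rparr>)"
    using assms by (intro add.subgroup_incl) (auto simp: additive_subgroup_def)
  then show ?thesis by (simp add: additive_subgroup_def)
qed

lemma (in direct_sum_decomposition) component_minus:
  assumes "x \<in> carrier R" "\<alpha> \<in> I"
  shows "component \<alpha> (\<ominus> x) = \<ominus> component \<alpha> x"
proof -
  have "component \<alpha> (x \<oplus> \<ominus> x) = component \<alpha> x \<oplus> component \<alpha> (\<ominus> x)"
    using assms by (intro component_add) auto
  then have "component \<alpha> (\<ominus> x) \<oplus> component \<alpha> x = \<zero>"
    using assms by (simp add: r_neg component_zero component_closed a_comm)
  then show ?thesis
    using assms by (intro minus_equality[symmetric]) (auto intro: component_closed)
qed

text \<open>
  The projections of the large ring restrict to the subring; in degree \<open>\<alpha>\<close>, the kernel of the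
  restricted projection is the subgroup required by the criterion.
\<close>

lemma (in direct_sum_decomposition) direct_sum_subring:
  assumes "ring R" and B: "subring B R"
    and comp: "\<And>x \<alpha>. x \<in> B \<Longrightarrow> \<alpha> \<in> I \<Longrightarrow> component \<alpha> x \<in> B"
  shows "internal_direct_sum (R\<lparr>carrier := B\<rparr>) I (\<lambda>\<alpha>. B \<inter> \<G> \<alpha>)"
proof -
  interpret ring R by fact
  have Bsub: "additive_subgroup B R"
    using B by (simp add: subring_def additive_subgroup_def)
  have Bc: "B \<subseteq> carrier R" by (rule additive_subgroup.a_subset[OF Bsub])
  have kernel: "additive_subgroup {x \<in> B. component \<alpha> x = \<zero>} R" if "\<alpha> \<in> I" for \<alpha>
  proof (rule additive_subgroupI, rule add.subgroupI)
    show "{x \<in> B. component \<alpha> x = \<zero>} \<subseteq> carrier R" using Bc by blast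
    show "{x \<in> B. component \<alpha> x = \<zero>} \<noteq> {}"
      using component_zero[OF that] additive_subgroup.zero_closed[OF Bsub] by blast
  next
    fix x assume x: "x \<in> {x \<in> B. component \<alpha> x = \<zero>}"
    then have c: "x \<in> carrier R" using Bc by blast
    have "component \<alpha> (\<ominus> x) = \<zero>" using x c that by (simp add: component_minus)
    then show "\<ominus> x \<in> {x \<in> B. component \<alpha> x = \<zero>}"
      using x additive_subgroup.a_inv_closed[OF Bsub] by blast
  next
    fix x y assume "x \<in> {x \<in> B. component \<alpha> x = \<zero>}" "y \<in> {x \<in> B. component \<alpha> x = \<zero>}"
    then show "x \<oplus> y \<in> {x \<in> B. component \<alpha> x = \<zero>}"
      using that Bc additive_subgroup.a_closed[OF Bsub] by (auto simp: component_add subset_iff)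
  qed
  show ?thesis
  proof (rule internal_direct_sumI)
    show "abelian_group (R\<lparr>carrier := B\<rparr>)"
      using subring_is_ring[OF B] by (rule ring.is_abelian_group)
  next
    fix \<alpha> assume \<alpha>: "\<alpha> \<in> I"
    have "additive_subgroup (B \<inter> \<G> \<alpha>) R"
      using Bsub subgroup[OF \<alpha>] by (simp add: additive_subgroup_def add.subgroups_Inter_pair)
    then show "additive_subgroup (B \<inter> \<G> \<alpha>) (R\<lparr>carrier := B\<rparr>)"
      using Bsub by (intro additive_subgroup_restrict is_abelian_group) auto
    let ?C = "{x \<in> B. component \<alpha> x = \<zero>}"
    have "additive_subgroup ?C (R\<lparr>carrier := B\<rparr>)"
      using Bsub kernel[OF \<alpha>] by (intro additive_subgroup_restrict is_abelian_group) auto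
    moreover have "\<forall>\<beta>\<in>I - {\<alpha>}. B \<inter> \<G> \<beta> \<subseteq> ?C"
      using \<alpha> by (auto simp: component_homogeneous)
    moreover have "(B \<inter> \<G> \<alpha>) \<inter> ?C \<subseteq> {\<zero>\<^bsub>R\<lparr>carrier := B\<rparr>\<^esub>}"
      using \<alpha> by (auto simp: component_homogeneous)
    ultimately show "\<exists>C. additive_subgroup C (R\<lparr>carrier := B\<rparr>) \<and>
        (\<forall>\<beta>\<in>I - {\<alpha>}. B \<inter> \<G> \<beta> \<subseteq> C) \<and> (B \<inter> \<G> \<alpha>) \<inter> C \<subseteq> {\<zero>\<^bsub>R\<lparr>carrier := B\<rparr>\<^esub>}"
      by blast
  next
    fix x C
    assume x: "x \<in> carrier (R\<lparr>carrier := B\<rparr>)" and C: "additive_subgroup C (R\<lparr>carrier := B\<rparr>)"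
      and sub: "\<And>\<alpha>. \<alpha> \<in> I \<Longrightarrow> B \<inter> \<G> \<alpha> \<subseteq> C"
    have xc: "x \<in> carrier R" using x Bc by auto
    then show "x \<in> C"
    proof (induction rule: component_induct)
      case (component \<alpha>)
      then show ?case using x comp[of x \<alpha>] component_in[OF xc] sub by auto
    next
      case zero
      then show ?case using additive_subgroup.zero_closed[OF C] by simp
    next
      case (add y z)
      then show ?case using additive_subgroup.a_closed[OF C] by simp
    qed
  qed
qed

text \<open>
  The inclusion of the subring preserves degrees, so it commutes with taking components.
\<close>

lemma (in direct_sum_decomposition) component_subring:
  assumes "ring R" "subring B R" and sum: "internal_direct_sum (R\<lparr>carrier := B\<rparr>) I (\<lambda>\<alpha>. B \<inter> \<G> \<alpha>)"
    and x: "x \<in> B" and \<alpha>: "\<alpha> \<in> I"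
  shows "direct_sum_decomposition.component (R\<lparr>carrier := B\<rparr>) I (\<lambda>\<alpha>. B \<inter> \<G> \<alpha>) \<alpha> x = component \<alpha> x"
    and "component \<alpha> x \<in> B"
proof -
  have "abelian_group (R\<lparr>carrier := B\<rparr>)"
    using ring.subring_is_ring[OF assms(1,2)] by (rule ring.is_abelian_group)
  then interpret B: direct_sum_decomposition "R\<lparr>carrier := B\<rparr>" I "\<lambda>\<alpha>. B \<inter> \<G> \<alpha>"
    using sum by (simp add: direct_sum_decomposition_def direct_sum_decomposition_axioms_def)
  have "B \<subseteq> carrier R" using subringE(1)[OF assms(2)] .
  then have "id (B.component \<alpha> x) = component \<alpha> (id x)"
    using x \<alpha> by (intro B.homogeneous_map_component direct_sum_decomposition_axioms) auto
  then show "B.component \<alpha> x = component \<alpha> x" by simp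
  then show "component \<alpha> x \<in> B" using B.component_closed[of x \<alpha>] x \<alpha> by simp
qed

section \<open>Homogeneous ideals\<close>

text \<open>
  The elements all of whose components lie in \<open>J\<close> form an ideal, because a product of homogeneous
  elements is homogeneous. If \<open>J\<close> is generated by homogeneous elements, this ideal contains the
  generators and hence \<open>J\<close>. The index set may also be the quotient group, as for the
  gradings of overrings.
\<close>

lemma homogeneous_ideal_iff:
  fixes R (structure)
  assumes "ring R" and "direct_sum_decomposition R (carrier \<Gamma>) \<G>"
    and mult: "\<And>x y. \<lbrakk>x \<in> (\<Union>\<alpha>\<in>carrier \<Gamma>. \<G> \<alpha>); y \<in> (\<Union>\<alpha>\<in>carrier \<Gamma>. \<G> \<alpha>)\<rbrakk>
      \<Longrightarrow> x \<otimes> y \<in> (\<Union>\<alpha>\<in>carrier \<Gamma>. \<G> \<alpha>)"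
  shows "homogeneous_ideal \<Gamma> R \<G> J \<longleftrightarrow> ideal J R \<and>
    (\<forall>x\<in>J. \<forall>\<alpha>\<in>carrier \<Gamma>. direct_sum_decomposition.component R (carrier \<Gamma>) \<G> \<alpha> x \<in> J)"
proof -
  interpret ring R by fact
  interpret direct_sum_decomposition R "carrier \<Gamma>" \<G> by fact
  let ?U = "\<Union>\<alpha>\<in>carrier \<Gamma>. \<G> \<alpha>"
  have Uc: "x \<in> carrier R" if "x \<in> ?U" for x using that in_carrier by auto
  show ?thesis
  proof (intro iffI conjI)
    assume hom: "homogeneous_ideal \<Gamma> R \<G> J"
    then show J: "ideal J R" by (simp add: homogeneous_ideal_def)
    from hom obtain S where S: "S \<subseteq> ?U" "J = genideal R S"
      by (auto simp: homogeneous_ideal_def)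
    have SJ: "S \<subseteq> J" unfolding S(2) using S(1) Uc by (intro genideal_self) auto
    interpret J: ideal J R by (rule J)
    define L where "L = {x \<in> carrier R. \<forall>\<alpha>\<in>carrier \<Gamma>. component \<alpha> x \<in> J}"
    have L_add: "x \<oplus> y \<in> L" if "x \<in> L" "y \<in> L" for x y
      using that by (auto simp: L_def component_add)
    have L0: "\<zero> \<in> L" by (auto simp: L_def component_zero)
    have L_hom: "x \<in> L" if "x \<in> J" "x \<in> ?U" for x
      using that Uc by (auto simp: L_def component_homogeneous)
    have L_mult: "x \<otimes> r \<in> L \<and> r \<otimes> x \<in> L" if x: "x \<in> L" and r: "r \<in> carrier R" for x r
      using r
    proof (induction rule: component_induct)
      case (component \<rho>)
      let ?r = "component \<rho> r"
      have rc: "?r \<in> carrier R" "?r \<in> ?U" using component r component_in Uc by blast+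
      have "x \<in> carrier R" using x by (simp add: L_def)
      then show ?case
      proof (induction rule: component_induct)
        case (component \<alpha>)
        let ?x = "component \<alpha> x"
        have "?x \<in> J" "?x \<in> ?U" using x component component_in by (auto simp: L_def)
        then show ?case
          using rc mult J.I_l_closed J.I_r_closed by (intro conjI L_hom) auto
      next
        case zero
        then show ?case using L0 rc by simp
      next
        case (add y z)
        then show ?case using L_add rc by (simp add: l_distr r_distr)
      qed
    next
      case zero
      have "x \<in> carrier R" using x by (simp add: L_def)
      then show ?case using L0 by simp
    next
      case (add y z)
      have "x \<in> carrier R" using x by (simp add: L_def)
      then show ?case using L_add add by (simp add: l_distr r_distr)
    qed
    have "ideal L R"
    proof (rule idealI[OF \<open>ring R\<close>])
      show "Group.subgroup L (add_monoid R)"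
      proof (rule add.subgroupI)
        show "L \<subseteq> carrier R" "L \<noteq> {}" using L0 by (auto simp: L_def)
      next
        fix x assume x: "x \<in> L"
        then have "\<ominus> x = x \<otimes> \<ominus> \<one>" by (simp add: L_def r_minus)
        then show "\<ominus> x \<in> L" using L_mult[OF x, of "\<ominus> \<one>"] by simp
      qed (rule L_add)
    qed (use L_mult in auto)
    moreover have "S \<subseteq> L" using SJ S(1) L_hom by blast
    ultimately have "J \<subseteq> L" unfolding S(2) by (rule genideal_minimal)
    then show "\<forall>x\<in>J. \<forall>\<alpha>\<in>carrier \<Gamma>. component \<alpha> x \<in> J" by (auto simp: L_def)
  next
    assume asm: "ideal J R \<and> (\<forall>x\<in>J. \<forall>\<alpha>\<in>carrier \<Gamma>. component \<alpha> x \<in> J)"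
    interpret J: ideal J R using asm by blast
    have c: "J \<inter> ?U \<subseteq> carrier R" using J.a_subset by blast
    interpret G: ideal "genideal R (J \<inter> ?U)" R by (rule genideal_ideal[OF c])
    have "x \<in> genideal R (J \<inter> ?U)" if x: "x \<in> J" for x
    proof -
      have xc: "x \<in> carrier R" using x J.a_subset by blast
      then show ?thesis
      proof (induction rule: component_induct)
        case (component \<alpha>)
        then have "component \<alpha> x \<in> J \<inter> ?U" using asm x component_in[OF xc] by blast
        then show ?case using genideal_self[OF c] by blast
      qed auto
    qed
    moreover have "genideal R (J \<inter> ?U) \<subseteq> J" by (rule genideal_minimal) (use asm in auto)
    ultimately have "J = genideal R (J \<inter> ?U)" by blast
    then show "homogeneous_ideal \<Gamma> R \<G> J"
      using asm unfolding homogeneous_ideal_def by blast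
  qed
qed

section \<open>Graded domains\<close>

context graded_domain
begin

sublocale direct_sum_decomposition R "carrier \<Gamma>" \<G>
  by unfold_locales (rule direct_sum)

text \<open>
  Multiplication by \<open>t\<close> shifts degrees by \<open>\<tau>\<close>. In this form the lemma includes the degrees \<open>\<delta>\<close> that are
  not of the form \<open>\<rho> \<otimes> \<tau>\<close>, where there is no \<open>\<rho>\<close> to which the next lemma could be applied.
\<close>

lemma component_mult_homogeneous_zero:
  assumes x: "x \<in> carrier R" and t: "\<tau> \<in> carrier \<Gamma>" "t \<in> \<G> \<tau>" and \<delta>: "\<delta> \<in> carrier \<Gamma>"
    and zero: "\<And>\<rho>. \<lbrakk>\<rho> \<in> carrier \<Gamma>; \<rho> \<otimes>\<^bsub>\<Gamma>\<^esub> \<tau> = \<delta>\<rbrakk> \<Longrightarrow> component \<rho> x = \<zero>"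
  shows "component \<delta> (x \<otimes> t) = \<zero>"
proof -
  have tc: "t \<in> carrier R" using t in_carrier by blast
  show ?thesis using x
  proof (induction rule: component_induct)
    case (component \<rho>)
    have "component \<rho> x \<otimes> t \<in> \<G> (\<rho> \<otimes>\<^bsub>\<Gamma>\<^esub> \<tau>)"
      using component x t by (intro mult_closed component_in)
    then show ?case
      using component_homogeneous[of \<delta> "\<rho> \<otimes>\<^bsub>\<Gamma>\<^esub> \<tau>"] zero[of \<rho>] component t tc \<delta>
      by (auto simp: component_zero)
  next
    case zero
    then show ?case using tc \<delta> by (simp add: component_zero)
  next
    case (add y z)
    then show ?case using tc \<delta> by (simp add: l_distr component_add)
  qed
qed

lemma component_mult_homogeneous:
  assumes x: "x \<in> carrier R" and t: "\<tau> \<in> carrier \<Gamma>" "t \<in> \<G> \<tau>" and \<rho>: "\<rho> \<in> carrier \<Gamma>"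
  shows "component (\<rho> \<otimes>\<^bsub>\<Gamma>\<^esub> \<tau>) (x \<otimes> t) = component \<rho> x \<otimes> t"
proof -
  have tc: "t \<in> carrier R" using t in_carrier by blast
  show ?thesis using x
  proof (induction rule: component_induct)
    case (component \<alpha>)
    have "component \<alpha> x \<otimes> t \<in> \<G> (\<alpha> \<otimes>\<^bsub>\<Gamma>\<^esub> \<tau>)"
      using component x t by (intro mult_closed component_in)
    moreover have "\<rho> \<otimes>\<^bsub>\<Gamma>\<^esub> \<tau> = \<alpha> \<otimes>\<^bsub>\<Gamma>\<^esub> \<tau> \<longleftrightarrow> \<rho> = \<alpha>"
      using deg.cancel[of \<rho> \<alpha> \<tau>] component t \<rho> by blast
    ultimately show ?case
      using component_homogeneous[of "\<rho> \<otimes>\<^bsub>\<Gamma>\<^esub> \<tau>" "\<alpha> \<otimes>\<^bsub>\<Gamma>\<^esub> \<tau>"] component_in[OF x component]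
        component_homogeneous[of \<rho> \<alpha>] component t tc \<rho> by simp
  next
    case zero
    then show ?case using tc t \<rho> by (simp add: component_zero)
  next
    case (add y z)
    then show ?case using tc t \<rho> by (simp add: l_distr component_add component_closed)
  qed
qed

text \<open>
  For homogeneous \<open>x\<close>, comparing components of the degree of \<open>x\<close> in \<open>\<one> \<otimes> x = x\<close> shows \<open>e \<otimes> x = x\<close>,
  where \<open>e\<close> is the component of \<open>\<one>\<close> in the neutral degree. So \<open>e\<close> is a multiplicative identity and equals \<open>\<one>\<close>.
\<close>

lemma one_homogeneous: "\<one> \<in> \<G> \<one>\<^bsub>\<Gamma>\<^esub>"
proof -
  let ?e = "component \<one>\<^bsub>\<Gamma>\<^esub> \<one>"
  have e: "?e \<in> carrier R" by (rule component_closed) auto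
  have "?e \<otimes> x = x" if "x \<in> carrier R" for x
    using that
  proof (induction rule: component_induct)
    case (component \<alpha>)
    have c: "component \<alpha> x \<in> \<G> \<alpha>" "component \<alpha> x \<in> carrier R"
      using that component by (auto intro: component_in component_closed)
    then have "component (\<one>\<^bsub>\<Gamma>\<^esub> \<otimes>\<^bsub>\<Gamma>\<^esub> \<alpha>) (\<one> \<otimes> component \<alpha> x) = ?e \<otimes> component \<alpha> x"
      using component by (intro component_mult_homogeneous) auto
    then show ?case using c component by (simp add: component_homogeneous)
  qed (use e in \<open>auto simp: r_distr\<close>)
  from this[of \<one>] have "?e = \<one>" using e by simp
  then show ?thesis using component_in[of \<one> "\<one>\<^bsub>\<Gamma>\<^esub>"] by simp
qed

lemma homogeneous_ideal_iff_component:
  "homogeneous_ideal \<Gamma> R \<G> J \<longleftrightarrow> ideal J R \<and> (\<forall>x\<in>J. \<forall>\<alpha>\<in>carrier \<Gamma>. component \<alpha> x \<in> J)"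
proof (rule homogeneous_ideal_iff[OF ring_axioms direct_sum_decomposition_axioms])
  fix x y assume "x \<in> (\<Union>\<alpha>\<in>carrier \<Gamma>. \<G> \<alpha>)" "y \<in> (\<Union>\<alpha>\<in>carrier \<Gamma>. \<G> \<alpha>)"
  then show "x \<otimes> y \<in> (\<Union>\<alpha>\<in>carrier \<Gamma>. \<G> \<alpha>)"
    using mult_closed deg.m_closed by blast
qed

end

context graded_domain
begin
text \<open>
  If the cosets of \<open>x\<close> and of \<open>g \<in> \<G> \<alpha>\<close> coincide, then \<open>g\<close> and the component of \<open>x\<close> in degree \<open>\<alpha>\<close> differ
  by an element of \<open>P\<close>, as \<open>P\<close> contains the components of its elements. Hence the cosets of the \<open>x\<close> with
  \<open>component \<alpha> x \<in> P\<close> meet the image of \<open>\<G> \<alpha>\<close> in zero only.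
\<close>

lemma graded_domain_Quot:
  assumes "homogeneous_prime \<Gamma> R \<G> P"
  shows "graded_domain \<Gamma> (R Quot P) (quotient_grading R \<G> P)"
proof -
  have P: "primeideal P R" and comp: "\<And>x \<alpha>. x \<in> P \<Longrightarrow> \<alpha> \<in> carrier \<Gamma> \<Longrightarrow> component \<alpha> x \<in> P"
    using assms by (auto simp: homogeneous_prime_def homogeneous_ideal_iff_component)
  interpret P: primeideal P R by (rule P)
  interpret Q: domain "R Quot P" by (rule P.quotient_is_domain)
  note h = P.rcos_ring_hom_cring
  note [simp] = ring_hom_closed[OF P.rcos_ring_hom] ring_hom_cring.hom_zero[OF h]
    ring_hom_cring.hom_a_inv[OF h] ring_hom_add[OF P.rcos_ring_hom] ring_hom_mult[OF P.rcos_ring_hom]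
  let ?G = "quotient_grading R \<G> P"
  have zero: "P +> x = \<zero>\<^bsub>R Quot P\<^esub> \<longleftrightarrow> x \<in> P" if "x \<in> carrier R" for x
  proof -
    have "\<zero>\<^bsub>R Quot P\<^esub> = P" by (simp add: FactRing_def)
    then show ?thesis using that P.rcos_const_imp_mem P.a_rcos_const by metis
  qed
  have quot_cases: "\<exists>x\<in>carrier R. X = P +> x" if "X \<in> carrier (R Quot P)" for X
    using that by (auto simp: FactRing_def A_RCOSETS_def')
  have image: "additive_subgroup ((+>) P ` A) (R Quot P)" if "additive_subgroup A R" for A
  proof (rule additive_subgroupI, rule Q.add.subgroupI)
    have A: "A \<subseteq> carrier R" using that by (rule additive_subgroup.a_subset)
    show "(+>) P ` A \<subseteq> carrier (R Quot P)" using A by auto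
    show "(+>) P ` A \<noteq> {}" using additive_subgroup.zero_closed[OF that] by blast
    show "\<ominus>\<^bsub>R Quot P\<^esub> X \<in> (+>) P ` A" if X: "X \<in> (+>) P ` A" for X
    proof -
      obtain x where "x \<in> A" "X = P +> x" using X by blast
      then have "\<ominus>\<^bsub>R Quot P\<^esub> X = P +> (\<ominus> x)" "\<ominus> x \<in> A"
        using A additive_subgroup.a_inv_closed[OF \<open>additive_subgroup A R\<close>]
        by (simp_all add: subset_iff)
      then show ?thesis by blast
    qed
    show "X \<oplus>\<^bsub>R Quot P\<^esub> Y \<in> (+>) P ` A" if X: "X \<in> (+>) P ` A" "Y \<in> (+>) P ` A" for X Y
    proof -
      obtain x y where xy: "x \<in> A" "X = P +> x" "y \<in> A" "Y = P +> y" using X by blast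
      then have "X \<oplus>\<^bsub>R Quot P\<^esub> Y = P +> (x \<oplus> y)" using A by (simp add: subset_iff)
      then show ?thesis using xy additive_subgroup.a_closed[OF \<open>additive_subgroup A R\<close>] by blast
    qed
  qed
  show ?thesis
  proof (intro graded_domain.intro graded_domain_axioms.intro)
    show "grading_monoid \<Gamma>" by (rule deg.grading_monoid_axioms)
    show "domain (R Quot P)" by (rule Q.domain_axioms)
    show "internal_direct_sum (R Quot P) (carrier \<Gamma>) ?G"
    proof (rule internal_direct_sumI)
      show "abelian_group (R Quot P)" by (rule Q.is_abelian_group)
    next
      fix \<alpha> assume \<alpha>: "\<alpha> \<in> carrier \<Gamma>"
      show "additive_subgroup (?G \<alpha>) (R Quot P)"
        unfolding quotient_grading_def by (rule image[OF subgroup[OF \<alpha>]])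
      let ?K = "{x \<in> carrier R. component \<alpha> x \<in> P}"
      have "additive_subgroup ?K R"
      proof (rule additive_subgroupI, rule add.subgroupI)
        show "?K \<noteq> {}" using component_zero[OF \<alpha>] P.zero_closed by force
      next
        fix x assume x: "x \<in> ?K"
        then show "\<ominus> x \<in> ?K" using \<alpha> by (auto simp: component_minus)
      qed (use \<alpha> in \<open>auto simp: component_add\<close>)
      note image[OF this]
      moreover have "\<forall>\<beta>\<in>carrier \<Gamma> - {\<alpha>}. ?G \<beta> \<subseteq> (+>) P ` ?K"
        using \<alpha> in_carrier by (auto simp: quotient_grading_def component_homogeneous)
      moreover have "?G \<alpha> \<inter> (+>) P ` ?K \<subseteq> {\<zero>\<^bsub>R Quot P\<^esub>}"
      proof
        fix X assume "X \<in> ?G \<alpha> \<inter> (+>) P ` ?K"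
        then obtain g x where g: "g \<in> \<G> \<alpha>" "X = P +> g"
          and x: "x \<in> carrier R" "component \<alpha> x \<in> P" "X = P +> x"
          by (auto simp: quotient_grading_def)
        have gc: "g \<in> carrier R" using g \<alpha> in_carrier by blast
        have "g \<in> P +> x" using g x gc P.a_rcos_self by metis
        then obtain p where p: "p \<in> P" "g = p \<oplus> x" by (auto simp: a_r_coset_def')
        have "component \<alpha> g = component \<alpha> p \<oplus> component \<alpha> x"
          unfolding p(2) using p x \<alpha> by (intro component_add) auto
        then have "g \<in> P" using g \<alpha> comp[OF p(1) \<alpha>] x by (auto simp: component_homogeneous)
        then show "X \<in> {\<zero>\<^bsub>R Quot P\<^esub>}" using g zero gc by simp
      qed
      ultimately show "\<exists>B. additive_subgroup B (R Quot P) \<and>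
          (\<forall>\<beta>\<in>carrier \<Gamma> - {\<alpha>}. ?G \<beta> \<subseteq> B) \<and> ?G \<alpha> \<inter> B \<subseteq> {\<zero>\<^bsub>R Quot P\<^esub>}" by blast
    next
      fix X B assume X: "X \<in> carrier (R Quot P)" and B: "additive_subgroup B (R Quot P)"
        and sub: "\<And>\<alpha>. \<alpha> \<in> carrier \<Gamma> \<Longrightarrow> ?G \<alpha> \<subseteq> B"
      obtain x where x: "x \<in> carrier R" "X = P +> x" using quot_cases[OF X] by blast
      have "P +> x \<in> B" using x(1)
      proof (induction rule: component_induct)
        case (component \<alpha>)
        then show ?case
          using sub[of \<alpha>] component_in[OF x(1)] by (auto simp: quotient_grading_def)
      next
        case zero
        then show ?case using additive_subgroup.zero_closed[OF B] by simp
      next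
        case (add y z)
        then show ?case using additive_subgroup.a_closed[OF B] by simp
      qed
      then show "X \<in> B" using x by simp
    qed
  next
    fix \<alpha> \<beta> X Y
    assume ab: "\<alpha> \<in> carrier \<Gamma>" "\<beta> \<in> carrier \<Gamma>" and XY: "X \<in> ?G \<alpha>" "Y \<in> ?G \<beta>"
    then obtain x y where xy: "x \<in> \<G> \<alpha>" "y \<in> \<G> \<beta>" "X = P +> x" "Y = P +> y"
      by (auto simp: quotient_grading_def)
    then have "X \<otimes>\<^bsub>R Quot P\<^esub> Y = P +> (x \<otimes> y)"
      using in_carrier[OF ab(1) xy(1)] in_carrier[OF ab(2) xy(2)] by simp
    then show "X \<otimes>\<^bsub>R Quot P\<^esub> Y \<in> ?G (\<alpha> \<otimes>\<^bsub>\<Gamma>\<^esub> \<beta>)"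
      using mult_closed[OF ab xy(1,2)] by (simp add: quotient_grading_def)
  qed
qed

end

section \<open>Rings of fractions\<close>

locale fractions = domain R for R :: "('a, 'n) ring_scheme" (structure) +
  fixes S :: "'a set"
  assumes S_nonzero: "S \<subseteq> carrier R - {\<zero>}"
    and S_one: "\<one> \<in> S"
    and S_mult: "\<And>s t. s \<in> S \<Longrightarrow> t \<in> S \<Longrightarrow> s \<otimes> t \<in> S"
begin

abbreviation frac :: "'a \<Rightarrow> 'a \<Rightarrow> ('a \<times> 'a) set" where
  "frac \<equiv> fraction R S"

abbreviation K :: "('a \<times> 'a) set ring" where
  "K \<equiv> ring_of_fractions R S"

lemma S_carrier: "s \<in> S \<Longrightarrow> s \<in> carrier R"
  using S_nonzero by blast

lemma frac_closed: "a \<in> carrier R \<Longrightarrow> b \<in> S \<Longrightarrow> frac a b \<in> carrier K"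
  by (auto simp: ring_of_fractions_def)

lemma frac_cases:
  assumes "U \<in> carrier K"
  obtains a b where "a \<in> carrier R" "b \<in> S" "U = frac a b"
  using assms by (auto simp: ring_of_fractions_def)

lemma frac_eq:
  "\<lbrakk>a \<in> carrier R; b \<in> S; c \<in> carrier R; d \<in> S\<rbrakk> \<Longrightarrow> frac a b = frac c d \<longleftrightarrow> a \<otimes> d = c \<otimes> b"
  by (rule fraction_eq_iff[OF S_nonzero])

lemma frac_mult:
  "\<lbrakk>a \<in> carrier R; b \<in> S; c \<in> carrier R; d \<in> S\<rbrakk>
    \<Longrightarrow> frac a b \<otimes>\<^bsub>K\<^esub> frac c d = frac (a \<otimes> c) (b \<otimes> d)"
  by (rule fraction_mult[OF S_nonzero S_mult])

lemma frac_add: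
  "\<lbrakk>a \<in> carrier R; b \<in> S; c \<in> carrier R; d \<in> S\<rbrakk>
    \<Longrightarrow> frac a b \<oplus>\<^bsub>K\<^esub> frac c d = frac (a \<otimes> d \<oplus> c \<otimes> b) (b \<otimes> d)"
  by (rule fraction_add[OF S_nonzero S_mult])

lemma frac_zero: "b \<in> S \<Longrightarrow> frac \<zero> b = \<zero>\<^bsub>K\<^esub>"
  using frac_eq[of \<zero> b \<zero> \<one>] S_one S_carrier by (simp add: ring_of_fractions_def)

lemma frac_one: "frac \<one> \<one> = \<one>\<^bsub>K\<^esub>"
  by (simp add: ring_of_fractions_def)

lemma frac_eq_zero: "a \<in> carrier R \<Longrightarrow> b \<in> S \<Longrightarrow> frac a b = \<zero>\<^bsub>K\<^esub> \<longleftrightarrow> a = \<zero>"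
  using frac_zero[OF S_one] frac_eq[of a b \<zero> \<one>] S_one S_carrier by simp

lemma frac_add_same:
  assumes "a \<in> carrier R" "b \<in> S" "c \<in> carrier R"
  shows "frac a b \<oplus>\<^bsub>K\<^esub> frac c b = frac (a \<oplus> c) b"
proof -
  note S_carrier[OF assms(2)] S_mult[OF assms(2,2)]
  then show ?thesis
    using assms by (subst frac_add, simp_all, subst frac_eq) (auto simp: l_distr m_assoc)
qed

lemma ring_of_fractions_domain: "domain K"
proof (intro domain.intro cringI domain_axioms.intro)
  note carr = S_carrier S_mult S_one
  show "abelian_group K"
  proof (rule abelian_groupI)
    fix x y z assume "x \<in> carrier K" "y \<in> carrier K" "z \<in> carrier K"
    then obtain a b c d e f where "a \<in> carrier R" "b \<in> S" "c \<in> carrier R" "d \<in> S"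
      "e \<in> carrier R" "f \<in> S" "x = frac a b" "y = frac c d" "z = frac e f"
      by (meson frac_cases)
    then show "x \<oplus>\<^bsub>K\<^esub> y \<oplus>\<^bsub>K\<^esub> z = x \<oplus>\<^bsub>K\<^esub> (y \<oplus>\<^bsub>K\<^esub> z)"
      by (simp add: frac_add carr l_distr r_distr m_ac a_ac)
  next
    fix x y assume "x \<in> carrier K" "y \<in> carrier K"
    then obtain a b c d where "a \<in> carrier R" "b \<in> S" "c \<in> carrier R" "d \<in> S"
      "x = frac a b" "y = frac c d" by (meson frac_cases)
    then show "x \<oplus>\<^bsub>K\<^esub> y = y \<oplus>\<^bsub>K\<^esub> x" "x \<oplus>\<^bsub>K\<^esub> y \<in> carrier K"
      by (simp_all add: frac_add carr m_ac a_ac frac_closed)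
  next
    fix x assume "x \<in> carrier K"
    then obtain a b where ab: "a \<in> carrier R" "b \<in> S" "x = frac a b" by (meson frac_cases)
    then show "\<zero>\<^bsub>K\<^esub> \<oplus>\<^bsub>K\<^esub> x = x"
      by (simp add: frac_zero[OF S_one, symmetric] frac_add carr)
    have "frac (\<ominus> a) b \<oplus>\<^bsub>K\<^esub> x = \<zero>\<^bsub>K\<^esub>"
      using ab by (simp add: frac_add_same carr l_neg frac_zero)
    then show "\<exists>y\<in>carrier K. y \<oplus>\<^bsub>K\<^esub> x = \<zero>\<^bsub>K\<^esub>" using frac_closed ab by blast
  next
    show "\<zero>\<^bsub>K\<^esub> \<in> carrier K" using frac_closed[of \<zero> \<one>] frac_zero S_one by simp
  qed
  show "comm_monoid K"
  proof (rule comm_monoidI)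
    fix x y z assume "x \<in> carrier K" "y \<in> carrier K" "z \<in> carrier K"
    then obtain a b c d e f where "a \<in> carrier R" "b \<in> S" "c \<in> carrier R" "d \<in> S"
      "e \<in> carrier R" "f \<in> S" "x = frac a b" "y = frac c d" "z = frac e f"
      by (meson frac_cases)
    then show "x \<otimes>\<^bsub>K\<^esub> y \<otimes>\<^bsub>K\<^esub> z = x \<otimes>\<^bsub>K\<^esub> (y \<otimes>\<^bsub>K\<^esub> z)"
      by (simp add: frac_mult carr m_ac)
  next
    fix x y assume "x \<in> carrier K" "y \<in> carrier K"
    then obtain a b c d where "a \<in> carrier R" "b \<in> S" "c \<in> carrier R" "d \<in> S"
      "x = frac a b" "y = frac c d" by (meson frac_cases)
    then show "x \<otimes>\<^bsub>K\<^esub> y = y \<otimes>\<^bsub>K\<^esub> x" "x \<otimes>\<^bsub>K\<^esub> y \<in> carrier K"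
      by (simp_all add: frac_mult carr m_ac frac_closed)
  next
    fix x assume "x \<in> carrier K"
    then obtain a b where "a \<in> carrier R" "b \<in> S" "x = frac a b" by (meson frac_cases)
    then show "\<one>\<^bsub>K\<^esub> \<otimes>\<^bsub>K\<^esub> x = x"
      by (simp add: frac_one[symmetric] frac_mult carr)
  next
    show "\<one>\<^bsub>K\<^esub> \<in> carrier K" using frac_closed[of \<one> \<one>] frac_one S_one by simp
  qed
  show "(x \<oplus>\<^bsub>K\<^esub> y) \<otimes>\<^bsub>K\<^esub> z = x \<otimes>\<^bsub>K\<^esub> z \<oplus>\<^bsub>K\<^esub> y \<otimes>\<^bsub>K\<^esub> z"
    if xyz: "x \<in> carrier K" "y \<in> carrier K" "z \<in> carrier K" for x y z
  proof -
    from xyz obtain a b c d e f where r: "a \<in> carrier R" "b \<in> S" "c \<in> carrier R" "d \<in> S"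
      "e \<in> carrier R" "f \<in> S" "x = frac a b" "y = frac c d" "z = frac e f"
      by (meson frac_cases)
    note c = r(1-6) r(2,4,6)[THEN S_carrier]
    have "frac ((a \<otimes> d \<oplus> c \<otimes> b) \<otimes> e) (b \<otimes> d \<otimes> f)
        = frac (a \<otimes> e \<otimes> (d \<otimes> f) \<oplus> c \<otimes> e \<otimes> (b \<otimes> f)) (b \<otimes> f \<otimes> (d \<otimes> f))"
      using c by (subst frac_eq) (simp_all add: S_mult l_distr r_distr m_ac)
    then show ?thesis using c by (simp add: r(7-9) frac_mult frac_add S_mult)
  qed
  show "\<one>\<^bsub>K\<^esub> \<noteq> \<zero>\<^bsub>K\<^esub>" using frac_eq_zero[of \<one> \<one>] S_one by (simp add: frac_one)
  show "x = \<zero>\<^bsub>K\<^esub> \<or> y = \<zero>\<^bsub>K\<^esub>"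
    if xy: "x \<otimes>\<^bsub>K\<^esub> y = \<zero>\<^bsub>K\<^esub>" "x \<in> carrier K" "y \<in> carrier K" for x y
  proof -
    from xy obtain a b c d where r: "a \<in> carrier R" "b \<in> S" "c \<in> carrier R" "d \<in> S"
      "x = frac a b" "y = frac c d" by (meson frac_cases)
    with xy(1) show ?thesis by (simp add: frac_mult frac_eq_zero S_mult integral_iff)
  qed
qed

lemma frac_minus:
  assumes "a \<in> carrier R" "b \<in> S"
  shows "\<ominus>\<^bsub>K\<^esub> frac a b = frac (\<ominus> a) b"
proof -
  interpret K: domain K by (rule ring_of_fractions_domain)
  show ?thesis using assms
    by (intro K.minus_equality) (simp_all add: frac_add_same l_neg frac_zero frac_closed)
qed

end


section \<open>The grading of the homogeneous quotient field\<close>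

context graded_domain
begin

abbreviation H :: "'a set" where
  "H \<equiv> nonzero_homogeneous \<Gamma> R \<G>"

abbreviation RH :: "('a \<times> 'a) set ring" where
  "RH \<equiv> homogeneous_quotient_field \<Gamma> R \<G>"

abbreviation deg_frac :: "'g \<Rightarrow> 'g \<Rightarrow> ('g \<times> 'g) set" where
  "deg_frac \<equiv> fraction \<Gamma> (carrier \<Gamma>)"

abbreviation RH_grading :: "('g \<times> 'g) set \<Rightarrow> ('a \<times> 'a) set set" where
  "RH_grading \<equiv> quotient_field_grading \<Gamma> R \<G>"

lemma H_I: "\<sigma> \<in> carrier \<Gamma> \<Longrightarrow> s \<in> \<G> \<sigma> \<Longrightarrow> s \<noteq> \<zero> \<Longrightarrow> s \<in> H"
  by (auto simp: nonzero_homogeneous_def)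

lemma H_E:
  assumes "s \<in> H"
  obtains \<sigma> where "\<sigma> \<in> carrier \<Gamma>" "s \<in> \<G> \<sigma>" "s \<noteq> \<zero>"
  using assms by (auto simp: nonzero_homogeneous_def)

sublocale frac: fractions R H
proof
  show "H \<subseteq> carrier R - {\<zero>}" using in_carrier by (auto elim!: H_E)
  show "\<one> \<in> H" using one_homogeneous by (intro H_I[of "\<one>\<^bsub>\<Gamma>\<^esub>"]) auto
  show "s \<otimes> t \<in> H" if st: "s \<in> H" "t \<in> H" for s t
  proof -
    obtain \<sigma> where s: "\<sigma> \<in> carrier \<Gamma>" "s \<in> \<G> \<sigma>" "s \<noteq> \<zero>" using st(1) by (rule H_E)
    obtain \<tau> where t: "\<tau> \<in> carrier \<Gamma>" "t \<in> \<G> \<tau>" "t \<noteq> \<zero>" using st(2) by (rule H_E)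
    show ?thesis
      using s t mult_closed in_carrier by (intro H_I[of "\<sigma> \<otimes>\<^bsub>\<Gamma>\<^esub> \<tau>"]) (auto simp: integral_iff)
  qed
qed

lemmas frac_closed = frac.frac_closed[folded homogeneous_quotient_field_def]
  and frac_cases = frac.frac_cases[folded homogeneous_quotient_field_def]
  and frac_eq = frac.frac_eq
  and frac_mult = frac.frac_mult[folded homogeneous_quotient_field_def]
  and frac_add = frac.frac_add[folded homogeneous_quotient_field_def]
  and frac_add_same = frac.frac_add_same[folded homogeneous_quotient_field_def]
  and frac_zero = frac.frac_zero[folded homogeneous_quotient_field_def]
  and frac_one = frac.frac_one[folded homogeneous_quotient_field_def]
  and frac_eq_zero = frac.frac_eq_zero[folded homogeneous_quotient_field_def]
  and frac_minus = frac.frac_minus[folded homogeneous_quotient_field_def]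
  and RH_domain = frac.ring_of_fractions_domain[folded homogeneous_quotient_field_def]

sublocale RH: domain RH
  by (rule RH_domain)

lemma deg_frac_in: "\<alpha> \<in> carrier \<Gamma> \<Longrightarrow> \<beta> \<in> carrier \<Gamma> \<Longrightarrow> deg_frac \<alpha> \<beta> \<in> carrier (quotient_group \<Gamma>)"
  by (auto simp: quotient_group_def)

lemma frac_in_grading:
  assumes "\<alpha> \<in> carrier \<Gamma>" "\<beta> \<in> carrier \<Gamma>" "a \<in> \<G> \<alpha>" "b \<in> \<G> \<beta>" "b \<noteq> \<zero>"
  shows "frac.frac a b \<in> RH_grading (deg_frac \<alpha> \<beta>)"
proof (cases "a = \<zero>")
  case True
  then show ?thesis
    using assms by (simp add: frac_zero H_I quotient_field_grading_def)
next
  case False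
  then show ?thesis using assms unfolding quotient_field_grading_def by blast
qed

lemma grading_cases:
  assumes "U \<in> RH_grading \<gamma>"
  obtains "U = \<zero>\<^bsub>RH\<^esub>"
  | a b \<alpha> \<beta> where "\<alpha> \<in> carrier \<Gamma>" "\<beta> \<in> carrier \<Gamma>" "a \<in> \<G> \<alpha>" "b \<in> \<G> \<beta>" "a \<noteq> \<zero>" "b \<noteq> \<zero>"
      "\<gamma> = deg_frac \<alpha> \<beta>" "U = frac.frac a b"
  using assms unfolding quotient_field_grading_def by blast

lemma nonzero_grading_cases:
  assumes "U \<in> RH_grading \<gamma>" "U \<noteq> \<zero>\<^bsub>RH\<^esub>"
  obtains a b \<alpha> \<beta> where "\<alpha> \<in> carrier \<Gamma>" "\<beta> \<in> carrier \<Gamma>" "a \<in> \<G> \<alpha>" "b \<in> \<G> \<beta>" "a \<noteq> \<zero>" "b \<noteq> \<zero>"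
      "\<gamma> = deg_frac \<alpha> \<beta>" "U = frac.frac a b"
  using assms by (blast elim: grading_cases)

lemma zero_in_grading: "\<zero>\<^bsub>RH\<^esub> \<in> RH_grading \<gamma>"
  by (simp add: quotient_field_grading_def)

lemma grading_mult:
  assumes U: "U \<in> RH_grading \<gamma>" and V: "V \<in> RH_grading \<delta>"
  shows "U \<otimes>\<^bsub>RH\<^esub> V \<in> RH_grading (\<gamma> \<otimes>\<^bsub>quotient_group \<Gamma>\<^esub> \<delta>)"
proof -
  have VC: "V \<in> carrier RH" and UC: "U \<in> carrier RH"
    using U V by (auto elim!: grading_cases intro: frac_closed in_carrier H_I)
  from U show ?thesis
  proof (cases rule: grading_cases)
    case 1
    then show ?thesis using VC by (simp add: zero_in_grading)
  next
    case (2 a b \<alpha> \<beta>)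
    from V show ?thesis
    proof (cases rule: grading_cases)
      case 1
      then show ?thesis using UC by (simp add: zero_in_grading)
    next
      case (2 c d \<alpha>' \<beta>')
      note * = \<open>\<alpha> \<in> carrier \<Gamma>\<close> \<open>\<beta> \<in> carrier \<Gamma>\<close> \<open>a \<in> \<G> \<alpha>\<close> \<open>b \<in> \<G> \<beta>\<close> \<open>b \<noteq> \<zero>\<close> 2
      have "frac.frac (a \<otimes> c) (b \<otimes> d) \<in> RH_grading (deg_frac (\<alpha> \<otimes>\<^bsub>\<Gamma>\<^esub> \<alpha>') (\<beta> \<otimes>\<^bsub>\<Gamma>\<^esub> \<beta>'))"
        using * mult_closed in_carrier by (intro frac_in_grading) (auto simp: integral_iff)
      then show ?thesis
        using * \<open>\<gamma> = deg_frac \<alpha> \<beta>\<close> \<open>U = frac.frac a b\<close> in_carrier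
        by (simp add: frac_mult H_I deg.quotient_group_mult)
    qed
  qed
qed

lemma grading_subgroup:
  assumes "\<gamma> \<in> carrier (quotient_group \<Gamma>)"
  shows "additive_subgroup (RH_grading \<gamma>) RH"
proof (rule additive_subgroupI, rule RH.add.subgroupI)
  show c: "RH_grading \<gamma> \<subseteq> carrier RH"
    by (auto elim!: grading_cases intro: frac_closed in_carrier H_I)
  show "RH_grading \<gamma> \<noteq> {}" using zero_in_grading by blast
  show "\<ominus>\<^bsub>RH\<^esub> U \<in> RH_grading \<gamma>" if "U \<in> RH_grading \<gamma>" for U
    using that
  proof (cases rule: grading_cases)
    case (2 a b \<alpha> \<beta>)
    then show ?thesis
      using additive_subgroup.a_inv_closed[OF subgroup] in_carrier
      by (simp add: frac_minus H_I frac_in_grading)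
  qed (simp add: zero_in_grading)
  show "U \<oplus>\<^bsub>RH\<^esub> V \<in> RH_grading \<gamma>" if U: "U \<in> RH_grading \<gamma>" and V: "V \<in> RH_grading \<gamma>" for U V
  proof (cases "U = \<zero>\<^bsub>RH\<^esub> \<or> V = \<zero>\<^bsub>RH\<^esub>")
    case True
    then show ?thesis using U V c by auto
  next
    case False
    obtain a b \<alpha> \<beta> where 1: "\<alpha> \<in> carrier \<Gamma>" "\<beta> \<in> carrier \<Gamma>" "a \<in> \<G> \<alpha>" "b \<in> \<G> \<beta>" "b \<noteq> \<zero>"
      "\<gamma> = deg_frac \<alpha> \<beta>" "U = frac.frac a b"
      using U False by (blast elim: nonzero_grading_cases)
    obtain c d \<alpha>' \<beta>' where 2: "\<alpha>' \<in> carrier \<Gamma>" "\<beta>' \<in> carrier \<Gamma>" "c \<in> \<G> \<alpha>'" "d \<in> \<G> \<beta>'" "d \<noteq> \<zero>"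
      "\<gamma> = deg_frac \<alpha>' \<beta>'" "V = frac.frac c d"
      using V False by (blast elim: nonzero_grading_cases)
    have e: "\<alpha> \<otimes>\<^bsub>\<Gamma>\<^esub> \<beta>' = \<alpha>' \<otimes>\<^bsub>\<Gamma>\<^esub> \<beta>"
      using 1 2 deg.quotient_group_eq_iff by metis
    have "a \<otimes> d \<in> \<G> (\<alpha> \<otimes>\<^bsub>\<Gamma>\<^esub> \<beta>')" "c \<otimes> b \<in> \<G> (\<alpha> \<otimes>\<^bsub>\<Gamma>\<^esub> \<beta>')"
      using mult_closed[OF 1(1) 2(2) 1(3) 2(4)] mult_closed[OF 2(1) 1(2) 2(3) 1(4)] e by simp_all
    then have "a \<otimes> d \<oplus> c \<otimes> b \<in> \<G> (\<alpha> \<otimes>\<^bsub>\<Gamma>\<^esub> \<beta>')"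
      using 1 2 by (intro additive_subgroup.a_closed[OF subgroup]) auto
    then have "frac.frac (a \<otimes> d \<oplus> c \<otimes> b) (b \<otimes> d) \<in>
        RH_grading (deg_frac (\<alpha> \<otimes>\<^bsub>\<Gamma>\<^esub> \<beta>') (\<beta> \<otimes>\<^bsub>\<Gamma>\<^esub> \<beta>'))"
      using 1 2 in_carrier mult_closed
      by (intro frac_in_grading) (auto simp: integral_iff)
    moreover have "deg_frac (\<alpha> \<otimes>\<^bsub>\<Gamma>\<^esub> \<beta>') (\<beta> \<otimes>\<^bsub>\<Gamma>\<^esub> \<beta>') = \<gamma>"
      unfolding 1(6) using 1(1,2) 2(1,2) by (simp add: deg.quotient_group_eq_iff deg.m_ac)
    ultimately show ?thesis using 1 2 in_carrier by (simp add: frac_add H_I)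
  qed
qed

text \<open>
  Here \<open>B\<close> is the kernel of the projection of \<open>RH\<close> onto degree \<open>\<gamma>\<close>, which ought to send \<open>x/s\<close> to
  \<open>component \<rho> x / s\<close> when \<open>s\<close> has degree \<open>\<sigma>\<close> and \<open>deg_frac \<rho> \<sigma> = \<gamma>\<close>. Such a \<open>\<rho>\<close> is unique
  but may exist for one representation of a fraction and not for another. Requiring the condition for
  one representation only avoids proving that the projection is well defined.
\<close>

lemma other_degrees_subgroup:
  assumes \<gamma>: "\<gamma> \<in> carrier (quotient_group \<Gamma>)"
  defines "B \<equiv> {frac.frac x s | x s \<sigma>. x \<in> carrier R \<and> \<sigma> \<in> carrier \<Gamma> \<and> s \<in> \<G> \<sigma> \<and> s \<noteq> \<zero> \<and>
    (\<forall>\<rho>\<in>carrier \<Gamma>. deg_frac \<rho> \<sigma> = \<gamma> \<longrightarrow> component \<rho> x = \<zero>)}"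
  shows "additive_subgroup B RH"
    and "\<forall>\<delta>\<in>carrier (quotient_group \<Gamma>) - {\<gamma>}. RH_grading \<delta> \<subseteq> B"
    and "RH_grading \<gamma> \<inter> B \<subseteq> {\<zero>\<^bsub>RH\<^esub>}"
proof -
  have B_I: "frac.frac x s \<in> B"
    if "x \<in> carrier R" "\<sigma> \<in> carrier \<Gamma>" "s \<in> \<G> \<sigma>" "s \<noteq> \<zero>"
      "\<And>\<rho>. \<rho> \<in> carrier \<Gamma> \<Longrightarrow> deg_frac \<rho> \<sigma> = \<gamma> \<Longrightarrow> component \<rho> x = \<zero>" for x s \<sigma>
    using that unfolding B_def by blast
  have B_E: thesis
    if "U \<in> B" "\<And>x s \<sigma>. \<lbrakk>U = frac.frac x s; x \<in> carrier R; \<sigma> \<in> carrier \<Gamma>; s \<in> \<G> \<sigma>; s \<noteq> \<zero>;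
      \<And>\<rho>. \<rho> \<in> carrier \<Gamma> \<Longrightarrow> deg_frac \<rho> \<sigma> = \<gamma> \<Longrightarrow> component \<rho> x = \<zero>\<rbrakk> \<Longrightarrow> thesis" for U thesis
    using that unfolding B_def by blast
  have zero_B: "\<zero>\<^bsub>RH\<^esub> \<in> B"
    using B_I[of \<zero> "\<one>\<^bsub>\<Gamma>\<^esub>" \<one>] one_homogeneous frac_zero frac.S_one by (simp add: component_zero)
  have shift: "component \<rho>' (x \<otimes> t) = \<zero>"
    if x: "x \<in> carrier R" and s: "\<sigma> \<in> carrier \<Gamma>"
      "\<And>\<rho>. \<rho> \<in> carrier \<Gamma> \<Longrightarrow> deg_frac \<rho> \<sigma> = \<gamma> \<Longrightarrow> component \<rho> x = \<zero>"
      and t: "\<tau> \<in> carrier \<Gamma>" "t \<in> \<G> \<tau>" and \<rho>': "\<rho>' \<in> carrier \<Gamma>" "deg_frac \<rho>' (\<sigma> \<otimes>\<^bsub>\<Gamma>\<^esub> \<tau>) = \<gamma>"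
    for x \<sigma> t \<tau> \<rho>'
  proof (rule component_mult_homogeneous_zero[OF x t \<rho>'(1)])
    fix \<rho> assume \<rho>: "\<rho> \<in> carrier \<Gamma>" "\<rho> \<otimes>\<^bsub>\<Gamma>\<^esub> \<tau> = \<rho>'"
    have "deg_frac \<rho> \<sigma> = deg_frac \<rho>' (\<sigma> \<otimes>\<^bsub>\<Gamma>\<^esub> \<tau>)"
      using \<rho>(1) s(1) t(1) by (simp add: \<rho>(2)[symmetric] deg.quotient_group_eq_iff deg.m_ac)
    then show "component \<rho> x = \<zero>" using s(2) \<rho> \<rho>' by simp
  qed
  show "additive_subgroup B RH"
  proof (rule additive_subgroupI, rule RH.add.subgroupI)
    show "B \<subseteq> carrier RH" by (auto elim!: B_E intro: frac_closed H_I)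
    show "B \<noteq> {}" using zero_B by blast
    show "\<ominus>\<^bsub>RH\<^esub> U \<in> B" if "U \<in> B" for U
      using that
    proof (rule B_E)
      fix x s \<sigma> assume *: "U = frac.frac x s" "x \<in> carrier R" "\<sigma> \<in> carrier \<Gamma>" "s \<in> \<G> \<sigma>" "s \<noteq> \<zero>"
        "\<And>\<rho>. \<rho> \<in> carrier \<Gamma> \<Longrightarrow> deg_frac \<rho> \<sigma> = \<gamma> \<Longrightarrow> component \<rho> x = \<zero>"
      then have "frac.frac (\<ominus> x) s \<in> B" by (intro B_I) (auto simp: component_minus)
      then show ?thesis using * by (simp add: frac_minus H_I)
    qed
    show "U \<oplus>\<^bsub>RH\<^esub> V \<in> B" if U: "U \<in> B" and V: "V \<in> B" for U V
    proof (rule B_E[OF U], rule B_E[OF V])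
      fix x s \<sigma> y t \<tau>
      assume x: "U = frac.frac x s" "x \<in> carrier R" "\<sigma> \<in> carrier \<Gamma>" "s \<in> \<G> \<sigma>" "s \<noteq> \<zero>"
        "\<And>\<rho>. \<rho> \<in> carrier \<Gamma> \<Longrightarrow> deg_frac \<rho> \<sigma> = \<gamma> \<Longrightarrow> component \<rho> x = \<zero>"
        and y: "V = frac.frac y t" "y \<in> carrier R" "\<tau> \<in> carrier \<Gamma>" "t \<in> \<G> \<tau>" "t \<noteq> \<zero>"
        "\<And>\<rho>. \<rho> \<in> carrier \<Gamma> \<Longrightarrow> deg_frac \<rho> \<tau> = \<gamma> \<Longrightarrow> component \<rho> y = \<zero>"
      have c: "s \<in> carrier R" "t \<in> carrier R" using x y in_carrier by blast+
      have "frac.frac (x \<otimes> t \<oplus> y \<otimes> s) (s \<otimes> t) \<in> B"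
      proof (rule B_I[of _ "\<sigma> \<otimes>\<^bsub>\<Gamma>\<^esub> \<tau>"])
        fix \<rho> assume \<rho>: "\<rho> \<in> carrier \<Gamma>" "deg_frac \<rho> (\<sigma> \<otimes>\<^bsub>\<Gamma>\<^esub> \<tau>) = \<gamma>"
        have "component \<rho> (x \<otimes> t) = \<zero>"
          by (rule shift[OF x(2,3,6) y(3,4) \<rho>])
        moreover have "component \<rho> (y \<otimes> s) = \<zero>"
          using shift[OF y(2,3,6) x(3,4) \<rho>(1)] \<rho> x y by (simp add: deg.m_comm)
        ultimately show "component \<rho> (x \<otimes> t \<oplus> y \<otimes> s) = \<zero>"
          using x y c \<rho> by (simp add: component_add)
      qed (use x y c mult_closed in \<open>auto simp: integral_iff\<close>)
      then show ?thesis using x y by (simp add: frac_add H_I)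
    qed
  qed
  show "\<forall>\<delta>\<in>carrier (quotient_group \<Gamma>) - {\<gamma>}. RH_grading \<delta> \<subseteq> B"
  proof (intro ballI subsetI)
    fix \<delta> U assume \<delta>: "\<delta> \<in> carrier (quotient_group \<Gamma>) - {\<gamma>}" and "U \<in> RH_grading \<delta>"
    from this(2) show "U \<in> B"
    proof (cases rule: grading_cases)
      case 1
      then show ?thesis using zero_B by simp
    next
      case (2 a b \<alpha> \<beta>)
      have "component \<rho> a = \<zero>" if "\<rho> \<in> carrier \<Gamma>" "deg_frac \<rho> \<beta> = \<gamma>" for \<rho>
        using that 2 \<delta> by (auto simp: component_homogeneous)
      then show ?thesis using 2 in_carrier by (auto intro: B_I)
    qed
  qed
  show "RH_grading \<gamma> \<inter> B \<subseteq> {\<zero>\<^bsub>RH\<^esub>}"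
  proof
    fix U assume U: "U \<in> RH_grading \<gamma> \<inter> B"
    then have "U \<in> RH_grading \<gamma>" "U \<in> B" by auto
    from this(1) show "U \<in> {\<zero>\<^bsub>RH\<^esub>}"
    proof (cases rule: grading_cases)
      case ab: (2 a b \<alpha> \<beta>)
      from \<open>U \<in> B\<close> show ?thesis
      proof (rule B_E)
        fix x s \<sigma> assume x: "U = frac.frac x s" "x \<in> carrier R" "\<sigma> \<in> carrier \<Gamma>" "s \<in> \<G> \<sigma>" "s \<noteq> \<zero>"
          "\<And>\<rho>. \<rho> \<in> carrier \<Gamma> \<Longrightarrow> deg_frac \<rho> \<sigma> = \<gamma> \<Longrightarrow> component \<rho> x = \<zero>"
        have c: "a \<in> carrier R" "b \<in> carrier R" "s \<in> carrier R" using ab x in_carrier by blast+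
        have eq: "a \<otimes> s = x \<otimes> b"
          using frac_eq[of a b x s] ab x c by (simp add: H_I)
        have "deg_frac (\<alpha> \<otimes>\<^bsub>\<Gamma>\<^esub> \<sigma>) (\<sigma> \<otimes>\<^bsub>\<Gamma>\<^esub> \<beta>) = \<gamma>"
          unfolding \<open>\<gamma> = deg_frac \<alpha> \<beta>\<close>
          using ab(1,2) x(3) by (simp add: deg.quotient_group_eq_iff deg.m_ac)
        then have "component (\<alpha> \<otimes>\<^bsub>\<Gamma>\<^esub> \<sigma>) (x \<otimes> b) = \<zero>"
          using ab x by (intro shift[OF x(2,3,6)]) simp_all
        moreover have "a \<otimes> s \<in> \<G> (\<alpha> \<otimes>\<^bsub>\<Gamma>\<^esub> \<sigma>)" using ab x by (intro mult_closed)
        ultimately have "a \<otimes> s = \<zero>" 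
          using ab(1) x(3) component_homogeneous[of "\<alpha> \<otimes>\<^bsub>\<Gamma>\<^esub> \<sigma>" "\<alpha> \<otimes>\<^bsub>\<Gamma>\<^esub> \<sigma>"]
          by (simp flip: eq)
        then show ?thesis using ab x c by (simp add: integral_iff)
      qed
    qed simp
  qed
qed

theorem RH_direct_sum: "internal_direct_sum RH (carrier (quotient_group \<Gamma>)) RH_grading"
proof (rule internal_direct_sumI)
  show "abelian_group RH" by (rule RH.is_abelian_group)
next
  fix \<gamma> assume \<gamma>: "\<gamma> \<in> carrier (quotient_group \<Gamma>)"
  show "additive_subgroup (RH_grading \<gamma>) RH" by (rule grading_subgroup[OF \<gamma>])
  show "\<exists>B. additive_subgroup B RH \<and>
      (\<forall>\<delta>\<in>carrier (quotient_group \<Gamma>) - {\<gamma>}. RH_grading \<delta> \<subseteq> B) \<and>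
      RH_grading \<gamma> \<inter> B \<subseteq> {\<zero>\<^bsub>RH\<^esub>}"
    by (rule exI, rule conjI[OF _ conjI]) (rule other_degrees_subgroup[OF \<gamma>])+
next
  fix U B assume U: "U \<in> carrier RH" and B: "additive_subgroup B RH"
    and sub: "\<And>\<gamma>. \<gamma> \<in> carrier (quotient_group \<Gamma>) \<Longrightarrow> RH_grading \<gamma> \<subseteq> B"
  obtain x s where x: "x \<in> carrier R" "s \<in> H" "U = frac.frac x s" using U by (rule frac_cases)
  obtain \<sigma> where s: "\<sigma> \<in> carrier \<Gamma>" "s \<in> \<G> \<sigma>" "s \<noteq> \<zero>" using x(2) by (rule H_E)
  have "frac.frac x s \<in> B" using x(1)
  proof (induction rule: component_induct)
    case (component \<alpha>)
    then have "frac.frac (component \<alpha> x) s \<in> RH_grading (deg_frac \<alpha> \<sigma>)"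
      using x s by (intro frac_in_grading component_in)
    then show ?case using sub deg_frac_in component s by blast
  next
    case zero
    then show ?case using x additive_subgroup.zero_closed[OF B] by (simp add: frac_zero)
  next
    case (add y z)
    then show ?case
      using x additive_subgroup.a_closed[OF B] by (simp flip: frac_add_same)
  qed
  then show "U \<in> B" using x by simp
qed

sublocale RH: direct_sum_decomposition RH "carrier (quotient_group \<Gamma>)" RH_grading
  by unfold_locales (rule RH_direct_sum)

text \<open>
  A degree is either the difference of some \<open>\<rho>\<close> and the degree of the denominator, or it does not
  occur in the fraction at all; the next two lemmas treat these cases.
\<close>

lemma component_frac:
  assumes x: "x \<in> carrier R" and s: "\<sigma> \<in> carrier \<Gamma>" "s \<in> \<G> \<sigma>" "s \<noteq> \<zero>" and \<rho>: "\<rho> \<in> carrier \<Gamma>"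
  shows "RH.component (deg_frac \<rho> \<sigma>) (frac.frac x s) = frac.frac (component \<rho> x) s"
  using x
proof (induction rule: component_induct)
  case (component \<alpha>)
  have c: "component \<alpha> x \<in> \<G> \<alpha>" using x component by (rule component_in)
  then have "frac.frac (component \<alpha> x) s \<in> RH_grading (deg_frac \<alpha> \<sigma>)"
    using component s by (intro frac_in_grading)
  moreover have "deg_frac \<rho> \<sigma> = deg_frac \<alpha> \<sigma> \<longleftrightarrow> \<rho> = \<alpha>"
  proof -
    have "deg_frac \<rho> \<sigma> = deg_frac \<alpha> \<sigma> \<longleftrightarrow> \<rho> \<otimes>\<^bsub>\<Gamma>\<^esub> \<sigma> = \<alpha> \<otimes>\<^bsub>\<Gamma>\<^esub> \<sigma>"
      using \<rho> component s by (simp add: deg.quotient_group_eq_iff)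
    then show ?thesis using deg.cancel[of \<rho> \<alpha> \<sigma>] \<rho> component s by blast
  qed
  ultimately show ?case
    using c component s \<rho> deg_frac_in
    by (simp add: RH.component_homogeneous[of _ "deg_frac \<alpha> \<sigma>"] component_homogeneous[of \<rho> \<alpha>] frac_zero H_I)
next
  case zero
  then show ?case using s \<rho> by (simp add: component_zero frac_zero H_I RH.component_zero deg_frac_in)
next
  case (add y z)
  then show ?case
    using s \<rho> by (simp add: component_add component_closed frac_closed H_I RH.component_add
      deg_frac_in flip: frac_add_same)
qed

lemma component_frac_other:
  assumes x: "x \<in> carrier R" and s: "\<sigma> \<in> carrier \<Gamma>" "s \<in> \<G> \<sigma>" "s \<noteq> \<zero>"
    and \<gamma>: "\<gamma> \<in> carrier (quotient_group \<Gamma>)" "\<And>\<rho>. \<rho> \<in> carrier \<Gamma> \<Longrightarrow> deg_frac \<rho> \<sigma> \<noteq> \<gamma>"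
  shows "RH.component \<gamma> (frac.frac x s) = \<zero>\<^bsub>RH\<^esub>"
  using x
proof (induction rule: component_induct)
  case (component \<alpha>)
  then have "frac.frac (component \<alpha> x) s \<in> RH_grading (deg_frac \<alpha> \<sigma>)"
    using x s by (intro frac_in_grading component_in)
  then show ?case
    using RH.component_homogeneous[of \<gamma> "deg_frac \<alpha> \<sigma>"] \<gamma> component s deg_frac_in by simp metis
next
  case zero
  then show ?case using s \<gamma> by (simp add: frac_zero H_I RH.component_zero)
next
  case (add y z)
  then show ?case
    using s \<gamma> by (simp add: frac_closed H_I RH.component_add flip: frac_add_same)
qed

end

section \<open>Homogeneous overrings\<close>

context graded_domain
begin

text \<open>
  The direct sum condition on \<open>T\<close> becomes closure under the projections of the homogeneous quotient
  field, which is easy to transport along maps that commute with projections.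
\<close>

lemma homogeneous_overring_iff:
  "homogeneous_overring \<Gamma> R \<G> T \<longleftrightarrow> subring T RH \<and> embed \<Gamma> R \<G> ` carrier R \<subseteq> T \<and>
    (\<forall>U\<in>T. \<forall>\<gamma>\<in>carrier (quotient_group \<Gamma>). RH.component \<gamma> U \<in> T)"
proof (cases "subring T RH")
  case True
  have "internal_direct_sum (overring \<Gamma> R \<G> T) (carrier (quotient_group \<Gamma>))
      (overring_grading \<Gamma> R \<G> T) \<longleftrightarrow>
    (\<forall>U\<in>T. \<forall>\<gamma>\<in>carrier (quotient_group \<Gamma>). RH.component \<gamma> U \<in> T)"
    unfolding overring_grading_def
  proof (intro iffI ballI)
    fix U \<gamma> assume "internal_direct_sum (overring \<Gamma> R \<G> T) (carrier (quotient_group \<Gamma>))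
      (\<lambda>\<gamma>. T \<inter> RH_grading \<gamma>)" "U \<in> T" "\<gamma> \<in> carrier (quotient_group \<Gamma>)"
    then show "RH.component \<gamma> U \<in> T" by (rule RH.component_subring(2)[OF RH.ring_axioms True])
  next
    assume "\<forall>U\<in>T. \<forall>\<gamma>\<in>carrier (quotient_group \<Gamma>). RH.component \<gamma> U \<in> T"
    then show "internal_direct_sum (overring \<Gamma> R \<G> T) (carrier (quotient_group \<Gamma>))
      (\<lambda>\<gamma>. T \<inter> RH_grading \<gamma>)"
      by (intro RH.direct_sum_subring[OF RH.ring_axioms True]) simp
  qed
  then show ?thesis by (simp add: homogeneous_overring_def True)
qed (simp add: homogeneous_overring_def)

lemma overring_homogeneous_prime_iff:
  assumes T: "homogeneous_overring \<Gamma> R \<G> T"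
  shows "homogeneous_prime (quotient_group \<Gamma>) (overring \<Gamma> R \<G> T) (overring_grading \<Gamma> R \<G> T) Q \<longleftrightarrow>
    primeideal Q (overring \<Gamma> R \<G> T) \<and>
    (\<forall>U\<in>Q. \<forall>\<gamma>\<in>carrier (quotient_group \<Gamma>). RH.component \<gamma> U \<in> Q)"
proof -
  let ?T = "overring \<Gamma> R \<G> T" and ?G = "\<lambda>\<gamma>. T \<inter> RH_grading \<gamma>" and ?Q = "quotient_group \<Gamma>"
  have sub: "subring T RH" and sum: "internal_direct_sum ?T (carrier ?Q) ?G"
    using T by (simp_all add: homogeneous_overring_def overring_grading_def)
  have ring: "ring ?T" by (rule RH.subring_is_ring[OF sub])
  then have ds: "direct_sum_decomposition ?T (carrier ?Q) ?G"
    using sum by (simp add: direct_sum_decomposition_def direct_sum_decomposition_axioms_def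
      ring.is_abelian_group)
  have mult: "U \<otimes>\<^bsub>?T\<^esub> V \<in> (\<Union>\<gamma>\<in>carrier ?Q. ?G \<gamma>)"
    if UV: "U \<in> (\<Union>\<gamma>\<in>carrier ?Q. ?G \<gamma>)" "V \<in> (\<Union>\<gamma>\<in>carrier ?Q. ?G \<gamma>)" for U V
  proof -
    obtain \<gamma> where \<gamma>: "\<gamma> \<in> carrier ?Q" "U \<in> T" "U \<in> RH_grading \<gamma>" using UV(1) by blast
    obtain \<delta> where \<delta>: "\<delta> \<in> carrier ?Q" "V \<in> T" "V \<in> RH_grading \<delta>" using UV(2) by blast
    have "U \<otimes>\<^bsub>RH\<^esub> V \<in> RH_grading (\<gamma> \<otimes>\<^bsub>?Q\<^esub> \<delta>)" using \<gamma> \<delta> by (intro grading_mult)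
    moreover have "U \<otimes>\<^bsub>RH\<^esub> V \<in> T" using \<gamma> \<delta> subringE(6)[OF sub] by blast
    moreover have "\<gamma> \<otimes>\<^bsub>?Q\<^esub> \<delta> \<in> carrier ?Q"
    proof -
      obtain \<alpha> \<beta> where 1: "\<alpha> \<in> carrier \<Gamma>" "\<beta> \<in> carrier \<Gamma>" "\<gamma> = deg_frac \<alpha> \<beta>"
        using \<gamma>(1) by (auto simp: quotient_group_def)
      obtain \<alpha>' \<beta>' where 2: "\<alpha>' \<in> carrier \<Gamma>" "\<beta>' \<in> carrier \<Gamma>" "\<delta> = deg_frac \<alpha>' \<beta>'"
        using \<delta>(1) by (auto simp: quotient_group_def)
      show ?thesis using 1 2 by (simp add: deg.quotient_group_mult deg_frac_in)
    qed
    ultimately show ?thesis by simp blast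
  qed
  have comp: "direct_sum_decomposition.component ?T (carrier ?Q) ?G \<gamma> U = RH.component \<gamma> U"
    if "U \<in> T" "\<gamma> \<in> carrier ?Q" for U \<gamma>
    using RH.component_subring(1)[OF RH.ring_axioms sub sum that] .
  have QT: "Q \<subseteq> T" if "ideal Q ?T"
    using additive_subgroup.a_subset[OF ideal.axioms(1)[OF that]] by simp
  have "homogeneous_ideal ?Q ?T ?G Q \<longleftrightarrow> ideal Q ?T \<and>
      (\<forall>U\<in>Q. \<forall>\<gamma>\<in>carrier ?Q. RH.component \<gamma> U \<in> Q)"
    using homogeneous_ideal_iff[OF ring ds mult] comp QT by (simp add: subset_iff) metis
  then show ?thesis
    unfolding homogeneous_prime_def overring_grading_def using primeideal.axioms(1) by blast
qed

lemma homogeneous_prime_iff: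
  "homogeneous_prime \<Gamma> R \<G> P \<longleftrightarrow>
    primeideal P R \<and> (\<forall>x\<in>P. \<forall>\<alpha>\<in>carrier \<Gamma>. component \<alpha> x \<in> P)"
  unfolding homogeneous_prime_def homogeneous_ideal_iff_component
  using primeideal.axioms(1) by blast

end

section \<open>Prime ideals and surjective homomorphisms\<close>

text \<open>
  The prime ideals of \<open>B\<close> correspond to those of \<open>A\<close> that contain the kernel; the second claim says
  that passing to \<open>B\<close> loses no information about such an ideal.
\<close>

lemma primeideal_image:
  assumes "cring A" "cring B" and h: "h \<in> ring_hom A B"
    and surj: "\<And>y. y \<in> carrier B \<Longrightarrow> \<exists>x\<in>carrier A. y = h x"
    and I: "primeideal I A" and kernel: "\<And>x. x \<in> carrier A \<Longrightarrow> h x = \<zero>\<^bsub>B\<^esub> \<Longrightarrow> x \<in> I"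
  shows "primeideal (h ` I) B" and "x \<in> carrier A \<Longrightarrow> h x \<in> h ` I \<longleftrightarrow> x \<in> I"
proof -
  interpret A: cring A by fact
  interpret B: cring B by fact
  interpret I: primeideal I A by fact
  have hom: "ring_hom_cring A B h"
    by (intro ring_hom_cring.intro ring_hom_cring_axioms.intro \<open>cring A\<close> \<open>cring B\<close> h)
  note [simp] = ring_hom_closed[OF h] ring_hom_add[OF h] ring_hom_mult[OF h]
    ring_hom_cring.hom_a_inv[OF hom] ring_hom_cring.hom_zero[OF hom]
  have carr: "y \<in> carrier A" if "y \<in> I" for y using that I.a_subset by blast
  have iff: "h x \<in> h ` I \<longleftrightarrow> x \<in> I" if x: "x \<in> carrier A" for x
  proof
    assume "h x \<in> h ` I"
    then obtain y where y: "y \<in> I" "h x = h y" by blast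
    have "h (x \<ominus>\<^bsub>A\<^esub> y) = \<zero>\<^bsub>B\<^esub>" using x y carr by (simp add: A.minus_eq B.r_neg)
    then have "x \<ominus>\<^bsub>A\<^esub> y \<in> I" using x carr[OF y(1)] by (intro kernel A.minus_closed)
    then have "(x \<ominus>\<^bsub>A\<^esub> y) \<oplus>\<^bsub>A\<^esub> y \<in> I" using y(1) by (rule I.a_closed)
    moreover have "(x \<ominus>\<^bsub>A\<^esub> y) \<oplus>\<^bsub>A\<^esub> y = x"
      using x y carr by (simp add: A.minus_eq A.a_assoc A.l_neg)
    ultimately show "x \<in> I" by simp
  qed blast
  then show "x \<in> carrier A \<Longrightarrow> h x \<in> h ` I \<longleftrightarrow> x \<in> I" .
  show "primeideal (h ` I) B"
  proof (rule primeidealI, rule idealI)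
    show "ring B" by (rule B.ring_axioms)
    show "cring B" by fact
    show "Group.subgroup (h ` I) (add_monoid B)"
    proof (rule B.add.subgroupI)
      show "h ` I \<subseteq> carrier B" using carr by auto
      show "h ` I \<noteq> {}" using I.zero_closed by blast
    next
      fix y assume "y \<in> h ` I"
      then obtain x where x: "x \<in> I" "y = h x" by blast
      then have "\<ominus>\<^bsub>B\<^esub> y = h (\<ominus>\<^bsub>A\<^esub> x)" using carr by simp
      then show "\<ominus>\<^bsub>B\<^esub> y \<in> h ` I" using x by blast
    next
      fix y z assume "y \<in> h ` I" "z \<in> h ` I"
      then obtain x w where x: "x \<in> I" "y = h x" "w \<in> I" "z = h w" by blast
      then have "y \<oplus>\<^bsub>B\<^esub> z = h (x \<oplus>\<^bsub>A\<^esub> w)" using carr by simp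
      then show "y \<oplus>\<^bsub>B\<^esub> z \<in> h ` I" using x by blast
    qed
  next
    fix y z assume "y \<in> h ` I" "z \<in> carrier B"
    then obtain x w where x: "x \<in> I" "y = h x" "w \<in> carrier A" "z = h w" using surj by blast
    then have "z \<otimes>\<^bsub>B\<^esub> y = h (w \<otimes>\<^bsub>A\<^esub> x)" "y \<otimes>\<^bsub>B\<^esub> z = h (x \<otimes>\<^bsub>A\<^esub> w)" using carr by simp_all
    then show "z \<otimes>\<^bsub>B\<^esub> y \<in> h ` I" "y \<otimes>\<^bsub>B\<^esub> z \<in> h ` I"
      using I.I_l_closed I.I_r_closed x by blast+
  next
    have "\<one>\<^bsub>A\<^esub> \<notin> I" using I.one_imp_carrier I.I_notcarr by blast
    then have "\<one>\<^bsub>B\<^esub> \<notin> h ` I" using iff[of "\<one>\<^bsub>A\<^esub>"] ring_hom_one[OF h] by simp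
    then show "carrier B \<noteq> h ` I" using B.one_closed by blast
  next
    fix y z assume yz: "y \<in> carrier B" "z \<in> carrier B" "y \<otimes>\<^bsub>B\<^esub> z \<in> h ` I"
    then obtain x w where x: "x \<in> carrier A" "y = h x" "w \<in> carrier A" "z = h w"
      using surj by blast
    then have "h (x \<otimes>\<^bsub>A\<^esub> w) \<in> h ` I" using yz by simp
    then have "x \<otimes>\<^bsub>A\<^esub> w \<in> I" using iff x by blast
    then show "y \<in> h ` I \<or> z \<in> h ` I" using x I.I_prime by blast
  qed
qed

section \<open>Reduction modulo a homogeneous prime\<close>

locale graded_quotient = graded_domain \<Gamma> R \<G>
  for \<Gamma> :: "('g, 'm) monoid_scheme" and R :: "('a, 'n) ring_scheme" (structure) and \<G> +
  fixes P :: "'a set"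
  assumes homogeneous_prime: "homogeneous_prime \<Gamma> R \<G> P"
begin

sublocale P: primeideal P R
  using homogeneous_prime by (simp add: homogeneous_prime_def)

abbreviation RP :: "'a set ring" where
  "RP \<equiv> R Quot P"

abbreviation RP_grading :: "'g \<Rightarrow> 'a set set" where
  "RP_grading \<equiv> quotient_grading R \<G> P"

sublocale RP: graded_domain \<Gamma> RP RP_grading
  by (rule graded_domain_Quot[OF homogeneous_prime])

lemma coset_hom [simp]:
  "x \<in> carrier R \<Longrightarrow> P +> x \<in> carrier RP"
  "\<lbrakk>x \<in> carrier R; y \<in> carrier R\<rbrakk> \<Longrightarrow> P +> (x \<oplus> y) = (P +> x) \<oplus>\<^bsub>RP\<^esub> (P +> y)"
  "\<lbrakk>x \<in> carrier R; y \<in> carrier R\<rbrakk> \<Longrightarrow> P +> (x \<otimes> y) = (P +> x) \<otimes>\<^bsub>RP\<^esub> (P +> y)"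
  "P +> \<one> = \<one>\<^bsub>RP\<^esub>"
  using ring_hom_closed[OF P.rcos_ring_hom] ring_hom_add[OF P.rcos_ring_hom]
    ring_hom_mult[OF P.rcos_ring_hom] ring_hom_one[OF P.rcos_ring_hom] by simp_all

lemma coset_eq_zero:
  assumes "x \<in> carrier R"
  shows "P +> x = \<zero>\<^bsub>RP\<^esub> \<longleftrightarrow> x \<in> P"
proof -
  have "\<zero>\<^bsub>RP\<^esub> = P" by (simp only: FactRing_def ring.simps)
  moreover have "P +> x = P \<longleftrightarrow> x \<in> P"
    using P.rcos_const_imp_mem[OF assms] P.a_rcos_const by blast
  ultimately show ?thesis by simp
qed

lemma coset_cases:
  assumes "X \<in> carrier RP"
  obtains x where "x \<in> carrier R" "X = P +> x"
proof -
  have "X \<in> a_rcosets P" using assms by (simp only: FactRing_def partial_object.simps)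
  then show thesis using that unfolding A_RCOSETS_def' by blast
qed

lemma component_coset:
  assumes "x \<in> carrier R" "\<alpha> \<in> carrier \<Gamma>"
  shows "RP.component \<alpha> (P +> x) = P +> component \<alpha> x"
  by (rule homogeneous_map_component[OF RP.direct_sum_decomposition_axioms, symmetric])
    (use assms in \<open>auto simp: quotient_grading_def\<close>)

lemma coset_in_H:
  assumes "s \<in> H" "s \<notin> P"
  shows "P +> s \<in> RP.H"
proof -
  obtain \<sigma> where \<sigma>: "\<sigma> \<in> carrier \<Gamma>" "s \<in> \<G> \<sigma>" using assms(1) by (rule H_E)
  then have "P +> s \<noteq> \<zero>\<^bsub>RP\<^esub>" using assms coset_eq_zero in_carrier by blast
  moreover have "P +> s \<in> RP_grading \<sigma>" using \<sigma> by (simp add: quotient_grading_def)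
  ultimately show ?thesis using \<sigma> by (intro RP.H_I)
qed

lemma QH_cases:
  assumes "X \<in> RP.H"
  obtains s where "s \<in> H" "s \<notin> P" "X = P +> s"
proof -
  obtain \<sigma> where \<sigma>: "\<sigma> \<in> carrier \<Gamma>" "X \<in> RP_grading \<sigma>" "X \<noteq> \<zero>\<^bsub>RP\<^esub>"
    using assms by (rule RP.H_E)
  then obtain s where s: "s \<in> \<G> \<sigma>" "X = P +> s" by (auto simp: quotient_grading_def)
  then have "s \<notin> P" using \<sigma> coset_eq_zero in_carrier by blast
  moreover have "s \<in> H" using s \<sigma> \<open>s \<notin> P\<close> P.zero_closed by (intro H_I) auto
  ultimately show thesis using that s by blast
qed

text \<open>
  The localization of \<open>R\<close> at the homogeneous elements outside \<open>P\<close>, as a subring of \<open>RH\<close>.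
\<close>

definition localization :: "('a \<times> 'a) set set" where
  "localization = {frac.frac x s | x s. x \<in> carrier R \<and> s \<in> H \<and> s \<notin> P}"

text \<open>
  The map \<open>x/s \<mapsto> (P + x)/(P + s)\<close>, as a union over all representatives with admissible denominator;
  a fraction in \<open>localization\<close> may also be represented with a denominator in \<open>P\<close>.
\<close>

definition reduce :: "('a \<times> 'a) set \<Rightarrow> ('a set \<times> 'a set) set" where
  "reduce U = (\<Union>z\<in>{z \<in> U. snd z \<notin> P}. RP.frac.frac (P +> fst z) (P +> snd z))"

lemma localization_I: "\<lbrakk>x \<in> carrier R; s \<in> H; s \<notin> P\<rbrakk> \<Longrightarrow> frac.frac x s \<in> localization"
  by (auto simp: localization_def)

lemma localization_cases:
  assumes "U \<in> localization"
  obtains x s where "x \<in> carrier R" "s \<in> H" "s \<notin> P" "U = frac.frac x s"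
  using assms by (auto simp: localization_def)

lemma H_carrier: "s \<in> H \<Longrightarrow> s \<in> carrier R"
  by (rule frac.S_carrier)

lemma denominator_mult: "\<lbrakk>s \<in> H; s \<notin> P; t \<in> H; t \<notin> P\<rbrakk> \<Longrightarrow> s \<otimes> t \<in> H \<and> s \<otimes> t \<notin> P"
  using frac.S_mult P.I_prime H_carrier by blast

lemma one_denominator: "\<one> \<in> H \<and> \<one> \<notin> P"
  using frac.S_one P.I_notcarr P.one_imp_carrier by blast

lemma reduce_frac:
  assumes x: "x \<in> carrier R" "s \<in> H" "s \<notin> P"
  shows "reduce (frac.frac x s) = RP.frac.frac (P +> x) (P +> s)"
proof -
  have eq: "RP.frac.frac (P +> y) (P +> t) = RP.frac.frac (P +> x) (P +> s)"
    if "(y, t) \<in> frac.frac x s" "t \<notin> P" for y t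
  proof -
    have y: "y \<in> carrier R" "t \<in> H" "x \<otimes> t = y \<otimes> s"
      using that by (simp_all add: fraction_def)
    have "(P +> y) \<otimes>\<^bsub>RP\<^esub> (P +> s) = P +> (y \<otimes> s)" using x y(1) H_carrier by simp
    also have "\<dots> = P +> (x \<otimes> t)" by (simp only: y(3))
    also have "\<dots> = (P +> x) \<otimes>\<^bsub>RP\<^esub> (P +> t)" using x y(2) H_carrier by simp
    finally have "(P +> y) \<otimes>\<^bsub>RP\<^esub> (P +> s) = (P +> x) \<otimes>\<^bsub>RP\<^esub> (P +> t)" .
    then show ?thesis using x y that by (simp add: RP.frac_eq coset_in_H)
  qed
  have "(x, s) \<in> {z \<in> frac.frac x s. snd z \<notin> P}" using x by (simp add: fraction_def)
  then show ?thesis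
    unfolding reduce_def
  proof (rule UN_constant_eq, intro ballI)
    fix z assume "z \<in> {z \<in> frac.frac x s. snd z \<notin> P}"
    then show "RP.frac.frac (P +> fst z) (P +> snd z) = RP.frac.frac (P +> x) (P +> s)"
      by (intro eq) simp_all
  qed
qed

lemma localization_subring: "subring localization RH"
proof (rule RH.subringI)
  show "localization \<subseteq> carrier RH" by (auto elim!: localization_cases intro: frac_closed)
  show "\<one>\<^bsub>RH\<^esub> \<in> localization"
    using localization_I[of \<one> \<one>] one_denominator by (simp add: frac_one)
next
  fix U assume "U \<in> localization"
  then show "\<ominus>\<^bsub>RH\<^esub> U \<in> localization"
    by (rule localization_cases) (simp add: frac_minus localization_I)
next
  fix U V assume U: "U \<in> localization" and V: "V \<in> localization"
  obtain x s where x: "x \<in> carrier R" "s \<in> H" "s \<notin> P" "U = frac.frac x s"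
    using U by (rule localization_cases)
  obtain y t where y: "y \<in> carrier R" "t \<in> H" "t \<notin> P" "V = frac.frac y t"
    using V by (rule localization_cases)
  show "U \<otimes>\<^bsub>RH\<^esub> V \<in> localization" "U \<oplus>\<^bsub>RH\<^esub> V \<in> localization"
    using x y denominator_mult[of s t] H_carrier
    by (simp_all add: frac_mult frac_add localization_I)
qed

lemma localization_carrier: "U \<in> localization \<Longrightarrow> U \<in> carrier RH"
  using subringE(1)[OF localization_subring] by blast

lemma reduce_hom:
  assumes U: "U \<in> localization" and V: "V \<in> localization"
  shows "reduce U \<in> carrier RP.RH" "reduce (U \<otimes>\<^bsub>RH\<^esub> V) = reduce U \<otimes>\<^bsub>RP.RH\<^esub> reduce V"
    "reduce (U \<oplus>\<^bsub>RH\<^esub> V) = reduce U \<oplus>\<^bsub>RP.RH\<^esub> reduce V"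
proof -
  obtain x s where x: "x \<in> carrier R" "s \<in> H" "s \<notin> P" "U = frac.frac x s"
    using U by (rule localization_cases)
  obtain y t where y: "y \<in> carrier R" "t \<in> H" "t \<notin> P" "V = frac.frac y t"
    using V by (rule localization_cases)
  note * = x y denominator_mult[of s t] H_carrier[of s] H_carrier[of t]
  show "reduce U \<in> carrier RP.RH" using * by (simp add: reduce_frac RP.frac_closed coset_in_H)
  show "reduce (U \<otimes>\<^bsub>RH\<^esub> V) = reduce U \<otimes>\<^bsub>RP.RH\<^esub> reduce V"
    using * by (simp add: frac_mult reduce_frac RP.frac_mult coset_in_H)
  show "reduce (U \<oplus>\<^bsub>RH\<^esub> V) = reduce U \<oplus>\<^bsub>RP.RH\<^esub> reduce V"
    using * by (simp add: frac_add reduce_frac RP.frac_add coset_in_H)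
qed

lemma reduce_one: "reduce \<one>\<^bsub>RH\<^esub> = \<one>\<^bsub>RP.RH\<^esub>"
  using reduce_frac[of \<one> \<one>] one_denominator by (simp add: frac_one RP.frac_one)

lemma reduce_zero: "reduce \<zero>\<^bsub>RH\<^esub> = \<zero>\<^bsub>RP.RH\<^esub>"
proof -
  have "P +> \<zero> = \<zero>\<^bsub>RP\<^esub>" by (simp add: coset_eq_zero)
  then show ?thesis
    using reduce_frac[of \<zero> \<one>] one_denominator
    by (simp add: frac_zero RP.frac_zero RP.frac.S_one)
qed

text \<open>
  A nonzero homogeneous element of \<open>RP\<close> is the coset of a homogeneous element outside \<open>P\<close>, so every
  fraction over \<open>RP\<close> lifts. Hence overrings of \<open>RP\<close> are quotients of subrings of \<open>localization\<close>.
\<close>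

lemma reduce_surj:
  assumes "V \<in> carrier RP.RH"
  obtains U where "U \<in> localization" "V = reduce U"
proof -
  obtain X Y where XY: "X \<in> carrier RP" "Y \<in> RP.H" "V = RP.frac.frac X Y"
    using assms by (rule RP.frac_cases)
  obtain x where x: "x \<in> carrier R" "X = P +> x" using XY(1) by (rule coset_cases)
  obtain s where s: "s \<in> H" "s \<notin> P" "Y = P +> s" using XY(2) by (rule QH_cases)
  show thesis
    using that[of "frac.frac x s"] x s XY by (simp add: localization_I reduce_frac)
qed

lemma localization_component:
  assumes U: "U \<in> localization" and \<gamma>: "\<gamma> \<in> carrier (quotient_group \<Gamma>)"
  shows "RH.component \<gamma> U \<in> localization"
    and "reduce (RH.component \<gamma> U) = RP.RH.component \<gamma> (reduce U)"
proof -
  obtain x s where x: "x \<in> carrier R" "s \<in> H" "s \<notin> P" "U = frac.frac x s"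
    using U by (rule localization_cases)
  obtain \<sigma> where s: "\<sigma> \<in> carrier \<Gamma>" "s \<in> \<G> \<sigma>" "s \<noteq> \<zero>" using x(2) by (rule H_E)
  have S: "P +> s \<in> RP_grading \<sigma>" "P +> s \<noteq> \<zero>\<^bsub>RP\<^esub>"
    using s x(3) coset_eq_zero in_carrier by (auto simp: quotient_grading_def)
  have "RH.component \<gamma> U \<in> localization \<and>
    reduce (RH.component \<gamma> U) = RP.RH.component \<gamma> (reduce U)"
  proof (cases "\<exists>\<rho>\<in>carrier \<Gamma>. deg_frac \<rho> \<sigma> = \<gamma>")
    case True
    then obtain \<rho> where \<rho>: "\<rho> \<in> carrier \<Gamma>" "\<gamma> = deg_frac \<rho> \<sigma>" by blast
    have "RH.component \<gamma> U = frac.frac (component \<rho> x) s"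
      unfolding \<rho>(2) x(4) using x s \<rho> by (intro component_frac)
    moreover have "RP.RH.component \<gamma> (reduce U) = RP.frac.frac (P +> component \<rho> x) (P +> s)"
      using RP.component_frac[of "P +> x" \<sigma> "P +> s" \<rho>] x s S \<rho>
      by (simp add: reduce_frac component_coset)
    ultimately show ?thesis using x \<rho> by (simp add: reduce_frac component_closed localization_I)
  next
    case False
    have "RH.component \<gamma> U = \<zero>\<^bsub>RH\<^esub>"
      unfolding x(4) using x s \<gamma> False by (intro component_frac_other) auto
    moreover have "RP.RH.component \<gamma> (reduce U) = \<zero>\<^bsub>RP.RH\<^esub>"
      using RP.component_frac_other[of "P +> x" \<sigma> "P +> s" \<gamma>] x s S \<gamma> False
      by (auto simp: reduce_frac)
    ultimately show ?thesis using reduce_zero subringE(2)[OF localization_subring] by simp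
  qed
  then show "RH.component \<gamma> U \<in> localization"
    "reduce (RH.component \<gamma> U) = RP.RH.component \<gamma> (reduce U)" by auto
qed

lemma reduce_embed:
  assumes "x \<in> carrier R"
  shows "embed \<Gamma> R \<G> x \<in> localization" "reduce (embed \<Gamma> R \<G> x) = embed \<Gamma> RP RP_grading (P +> x)"
  using assms one_denominator reduce_frac[of x \<one>]
  by (simp_all add: embed_def localization_I)

definition pullback :: "('a set \<times> 'a set) set set \<Rightarrow> ('a \<times> 'a) set set" where
  "pullback T = {U \<in> localization. reduce U \<in> T}"

text \<open>
  The pullback inherits its grading because \<open>reduce\<close> commutes with taking components.
\<close>

lemma pullback_overring:
  assumes T: "homogeneous_overring \<Gamma> RP RP_grading T"
  shows "homogeneous_overring \<Gamma> R \<G> (pullback T)"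
  unfolding homogeneous_overring_iff
proof (intro conjI ballI)
  have sub: "subring T RP.RH" and emb: "embed \<Gamma> RP RP_grading ` carrier RP \<subseteq> T"
    and comp: "\<And>V \<gamma>. V \<in> T \<Longrightarrow> \<gamma> \<in> carrier (quotient_group \<Gamma>) \<Longrightarrow> RP.RH.component \<gamma> V \<in> T"
    using T by (auto simp: RP.homogeneous_overring_iff)
  note L = subringE[OF localization_subring]
  show "subring (pullback T) RH"
  proof (rule RH.subringI)
    fix U assume U: "U \<in> pullback T"
    then have UL: "U \<in> localization" "reduce U \<in> T" by (auto simp: pullback_def)
    have mL: "\<ominus>\<^bsub>RH\<^esub> U \<in> localization" using UL L(5) by blast
    have "reduce (\<ominus>\<^bsub>RH\<^esub> U) \<oplus>\<^bsub>RP.RH\<^esub> reduce U = \<zero>\<^bsub>RP.RH\<^esub>"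
      using mL UL localization_carrier
      by (simp add: RH.l_neg reduce_zero flip: reduce_hom(3))
    then have "reduce (\<ominus>\<^bsub>RH\<^esub> U) = \<ominus>\<^bsub>RP.RH\<^esub> reduce U"
      using mL UL reduce_hom(1) by (intro RP.RH.minus_equality[symmetric]) auto
    then show "\<ominus>\<^bsub>RH\<^esub> U \<in> pullback T"
      using mL UL subringE(5)[OF sub] by (simp add: pullback_def)
  qed (use L subringE[OF sub] localization_carrier in \<open>auto simp: pullback_def reduce_hom reduce_one\<close>)
  show "embed \<Gamma> R \<G> ` carrier R \<subseteq> pullback T"
    using emb by (auto simp: pullback_def reduce_embed)
  show "RH.component \<gamma> U \<in> pullback T"
    if "U \<in> pullback T" "\<gamma> \<in> carrier (quotient_group \<Gamma>)" for U \<gamma>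
    using that comp by (simp add: pullback_def localization_component)
qed

lemma reduce_overring_hom:
  "reduce \<in> ring_hom (overring \<Gamma> R \<G> (pullback T)) (overring \<Gamma> RP RP_grading T)"
  by (rule ring_hom_memI) (auto simp: pullback_def reduce_hom reduce_one)

text \<open>
  The kernel of \<open>reduce\<close> is a divided prime of the pullback, as far as homogeneous primes can see. The
  reason is that a homogeneous fraction outside the kernel is \<open>a/s\<close> with \<open>a\<close> and \<open>s\<close> both outside \<open>P\<close>, so
  it is invertible in \<open>localization\<close>. Then \<open>m \<cdot> (s/a)\<close> still reduces to zero and therefore lies in every
  pullback, and \<open>m\<close> is a multiple of \<open>a/s\<close> there.
\<close>

lemma kernel_subset_prime:
  assumes T: "homogeneous_overring \<Gamma> RP RP_grading T"
    and Q: "homogeneous_prime (quotient_group \<Gamma>) (overring \<Gamma> R \<G> (pullback T))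
      (overring_grading \<Gamma> R \<G> (pullback T)) Q"
    and y: "y \<in> Q" "reduce y \<noteq> \<zero>\<^bsub>RP.RH\<^esub>"
    and m: "m \<in> localization" "reduce m = \<zero>\<^bsub>RP.RH\<^esub>"
  shows "m \<in> Q"
proof -
  have over: "homogeneous_overring \<Gamma> R \<G> (pullback T)" by (rule pullback_overring[OF T])
  have prime: "primeideal Q (overring \<Gamma> R \<G> (pullback T))"
    and comp: "\<And>U \<gamma>. U \<in> Q \<Longrightarrow> \<gamma> \<in> carrier (quotient_group \<Gamma>) \<Longrightarrow> RH.component \<gamma> U \<in> Q"
    using Q by (auto simp: overring_homogeneous_prime_iff[OF over])
  have ideal: "ideal Q (overring \<Gamma> R \<G> (pullback T))" using prime by (rule primeideal.axioms(1))
  have "Q \<subseteq> pullback T" using additive_subgroup.a_subset[OF ideal.axioms(1)[OF ideal]] by simp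
  then have "y \<in> localization" using y(1) by (auto simp: pullback_def)
  then obtain x s where x: "x \<in> carrier R" "s \<in> H" "s \<notin> P" "y = frac.frac x s"
    by (rule localization_cases)
  obtain \<sigma> where s: "\<sigma> \<in> carrier \<Gamma>" "s \<in> \<G> \<sigma>" "s \<noteq> \<zero>" using x(2) by (rule H_E)
  have "x \<notin> P"
    using y(2) x coset_eq_zero by (simp add: reduce_frac RP.frac_eq_zero coset_in_H)
  \<comment> \<open>This turns \<open>y\<close> into a homogeneous element of the prime outside the kernel.\<close>
  have "\<exists>\<rho>\<in>carrier \<Gamma>. component \<rho> x \<notin> P"
  proof (rule ccontr)
    assume none: "\<not> ?thesis"
    from x(1) have "x \<in> P"
      by (induction rule: component_induct) (use none in auto)
    with \<open>x \<notin> P\<close> show False by simp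
  qed
  then obtain \<rho> where \<rho>: "\<rho> \<in> carrier \<Gamma>" "component \<rho> x \<notin> P" by blast
  define a where "a = component \<rho> x"
  have a: "a \<in> \<G> \<rho>" "a \<notin> P" using \<rho> x by (simp_all add: a_def component_in)
  then have aH: "a \<in> H" using \<rho> P.zero_closed by (intro H_I) auto
  have "RH.component (deg_frac \<rho> \<sigma>) y = frac.frac a s"
    unfolding x(4) a_def using x s \<rho> by (intro component_frac)
  then have as: "frac.frac a s \<in> Q" using comp[OF y(1)] deg_frac_in \<rho> s by metis
  obtain z t where z: "z \<in> carrier R" "t \<in> H" "t \<notin> P" "m = frac.frac z t"
    using m(1) by (rule localization_cases)
  have zP: "z \<in> P"
    using m(2) z coset_eq_zero by (simp add: reduce_frac RP.frac_eq_zero coset_in_H)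
  \<comment> \<open>The product of \<open>m\<close> and the inverse of \<open>a/s\<close>.\<close>
  define w where "w = frac.frac (z \<otimes> s) (t \<otimes> a)"
  have ta: "t \<otimes> a \<in> H" "t \<otimes> a \<notin> P" using denominator_mult z a aH by auto
  have carr: "a \<in> carrier R" "s \<in> carrier R" "t \<in> carrier R"
    using aH x z H_carrier by auto
  have zsP: "z \<otimes> s \<in> P" using zP carr by (simp add: P.I_r_closed)
  have "reduce w = RP.frac.frac \<zero>\<^bsub>RP\<^esub> (P +> (t \<otimes> a))"
    using reduce_frac[of "z \<otimes> s" "t \<otimes> a"] ta z carr zsP coset_eq_zero[of "z \<otimes> s"]
    by (simp add: w_def)
  then have "reduce w = \<zero>\<^bsub>RP.RH\<^esub>" using RP.frac_zero coset_in_H ta by simp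
  moreover have "\<zero>\<^bsub>RP.RH\<^esub> \<in> T"
    using T subringE(2) by (auto simp: RP.homogeneous_overring_iff)
  moreover have "w \<in> localization" using ta z carr by (simp add: w_def localization_I)
  ultimately have "w \<in> carrier (overring \<Gamma> R \<G> (pullback T))" by (simp add: pullback_def)
  from ideal.I_l_closed[OF ideal as this] have "w \<otimes>\<^bsub>RH\<^esub> frac.frac a s \<in> Q" by simp
  moreover have "w \<otimes>\<^bsub>RH\<^esub> frac.frac a s = m"
  proof -
    have "w \<otimes>\<^bsub>RH\<^esub> frac.frac a s = frac.frac (z \<otimes> s \<otimes> a) (t \<otimes> a \<otimes> s)"
      unfolding w_def using ta z carr x by (intro frac_mult) auto
    also have "\<dots> = frac.frac z t"
    proof -
      have "t \<otimes> a \<otimes> s \<in> H" using ta x frac.S_mult by blast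
      moreover have "z \<otimes> s \<otimes> a \<otimes> t = z \<otimes> (t \<otimes> a \<otimes> s)" using z carr by (simp add: m_ac)
      ultimately show ?thesis using z carr by (simp only: frac_eq m_closed)
    qed
    finally show ?thesis using z by simp
  qed
  ultimately show ?thesis by simp
qed

lemma homogeneous_prime_vimage_coset:
  assumes "homogeneous_prime \<Gamma> RP RP_grading p"
  shows "homogeneous_prime \<Gamma> R \<G> {x \<in> carrier R. P +> x \<in> p}"
proof -
  have p: "primeideal p RP"
    and comp: "\<And>X \<alpha>. X \<in> p \<Longrightarrow> \<alpha> \<in> carrier \<Gamma> \<Longrightarrow> RP.component \<alpha> X \<in> p"
    using assms by (auto simp: RP.homogeneous_prime_iff)
  have "primeideal {x \<in> carrier R. P +> x \<in> p} R"
    by (rule ring_hom_ring.primeideal_vimage[OF P.rcos_ring_hom_ring is_cring p])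
  then show ?thesis
    using comp by (auto simp: homogeneous_prime_iff component_closed simp flip: component_coset)
qed

lemma homogeneous_prime_vimage_reduce:
  assumes T: "homogeneous_overring \<Gamma> RP RP_grading T"
    and q: "homogeneous_prime (quotient_group \<Gamma>) (overring \<Gamma> RP RP_grading T)
      (overring_grading \<Gamma> RP RP_grading T) q"
  shows "homogeneous_prime (quotient_group \<Gamma>) (overring \<Gamma> R \<G> (pullback T))
    (overring_grading \<Gamma> R \<G> (pullback T)) {U \<in> pullback T. reduce U \<in> q}"
proof -
  have over: "homogeneous_overring \<Gamma> R \<G> (pullback T)" by (rule pullback_overring[OF T])
  have dom: "domain (overring \<Gamma> R \<G> (pullback T))" "domain (overring \<Gamma> RP RP_grading T)"
    using over T RH.subring_is_domain RP.RH.subring_is_domain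
    by (simp_all add: homogeneous_overring_iff RP.homogeneous_overring_iff)
  have q': "primeideal q (overring \<Gamma> RP RP_grading T)"
    and comp: "\<And>V \<gamma>. V \<in> q \<Longrightarrow> \<gamma> \<in> carrier (quotient_group \<Gamma>) \<Longrightarrow> RP.RH.component \<gamma> V \<in> q"
    using q by (auto simp: RP.overring_homogeneous_prime_iff[OF T])
  have cring: "cring (overring \<Gamma> R \<G> (pullback T))" "cring (overring \<Gamma> RP RP_grading T)"
    using dom by (simp_all add: domain_def)
  then have "ring_hom_ring (overring \<Gamma> R \<G> (pullback T)) (overring \<Gamma> RP RP_grading T) reduce"
    using reduce_overring_hom[of T] by (intro ring_hom_ringI2) (simp_all add: cring_def)
  from ring_hom_ring.primeideal_vimage[OF this cring(1) q']
  have "primeideal {U \<in> pullback T. reduce U \<in> q} (overring \<Gamma> R \<G> (pullback T))" by simp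
  moreover have "RH.component \<gamma> U \<in> pullback T \<and> reduce (RH.component \<gamma> U) \<in> q"
    if U: "U \<in> pullback T" "reduce U \<in> q" and \<gamma>: "\<gamma> \<in> carrier (quotient_group \<Gamma>)" for U \<gamma>
  proof -
    have "RH.component \<gamma> U \<in> pullback T" using over U \<gamma> by (simp add: homogeneous_overring_iff)
    moreover have "U \<in> localization" using U by (simp add: pullback_def)
    ultimately show ?thesis using comp[OF U(2) \<gamma>] \<gamma> by (simp add: localization_component)
  qed
  ultimately show ?thesis by (simp add: overring_homogeneous_prime_iff[OF over])
qed

text \<open>
  The way back from the pullback to \<open>T\<close>, open only to the primes that contain the kernel of \<open>reduce\<close>.
\<close>

lemma homogeneous_prime_image_reduce:
  assumes T: "homogeneous_overring \<Gamma> RP RP_grading T"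
    and Q: "homogeneous_prime (quotient_group \<Gamma>) (overring \<Gamma> R \<G> (pullback T))
      (overring_grading \<Gamma> R \<G> (pullback T)) Q"
    and kernel: "\<And>m. m \<in> localization \<Longrightarrow> reduce m = \<zero>\<^bsub>RP.RH\<^esub> \<Longrightarrow> m \<in> Q"
  shows "homogeneous_prime (quotient_group \<Gamma>) (overring \<Gamma> RP RP_grading T)
      (overring_grading \<Gamma> RP RP_grading T) (reduce ` Q)"
    and "U \<in> pullback T \<Longrightarrow> reduce U \<in> reduce ` Q \<longleftrightarrow> U \<in> Q"
proof -
  have over: "homogeneous_overring \<Gamma> R \<G> (pullback T)" by (rule pullback_overring[OF T])
  have dom: "domain (overring \<Gamma> R \<G> (pullback T))" "domain (overring \<Gamma> RP RP_grading T)"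
    using over T RH.subring_is_domain RP.RH.subring_is_domain
    by (simp_all add: homogeneous_overring_iff RP.homogeneous_overring_iff)
  have cring: "cring (overring \<Gamma> R \<G> (pullback T))" "cring (overring \<Gamma> RP RP_grading T)"
    using dom by (simp_all add: domain_def)
  have prime: "primeideal Q (overring \<Gamma> R \<G> (pullback T))"
    and comp: "\<And>U \<gamma>. U \<in> Q \<Longrightarrow> \<gamma> \<in> carrier (quotient_group \<Gamma>) \<Longrightarrow> RH.component \<gamma> U \<in> Q"
    using Q by (auto simp: overring_homogeneous_prime_iff[OF over])
  have "Q \<subseteq> pullback T"
    using additive_subgroup.a_subset[OF ideal.axioms(1)[OF primeideal.axioms(1)[OF prime]]] by simp
  then have QL: "U \<in> localization" if "U \<in> Q" for U using that by (auto simp: pullback_def)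
  have TC: "T \<subseteq> carrier RP.RH"
    using T subringE(1) by (auto simp: RP.homogeneous_overring_iff)
  have surj: "\<exists>U\<in>carrier (overring \<Gamma> R \<G> (pullback T)). V = reduce U"
    if V: "V \<in> carrier (overring \<Gamma> RP RP_grading T)" for V
  proof -
    have "V \<in> T" using V by simp
    then have "V \<in> carrier RP.RH" using TC by blast
    then obtain U where "U \<in> localization" "V = reduce U" by (rule reduce_surj)
    then show ?thesis using \<open>V \<in> T\<close> by (auto simp: pullback_def)
  qed
  have ker: "U \<in> Q" if "U \<in> carrier (overring \<Gamma> R \<G> (pullback T))"
      "reduce U = \<zero>\<^bsub>overring \<Gamma> RP RP_grading T\<^esub>" for U
    using that kernel by (simp add: pullback_def)
  note image = primeideal_image[OF cring reduce_overring_hom surj prime ker]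
  show "U \<in> pullback T \<Longrightarrow> reduce U \<in> reduce ` Q \<longleftrightarrow> U \<in> Q" using image(2) by simp
  have "RP.RH.component \<gamma> (reduce U) \<in> reduce ` Q"
    if "U \<in> Q" "\<gamma> \<in> carrier (quotient_group \<Gamma>)" for U \<gamma>
    using comp[OF that] localization_component(2)[OF QL[OF that(1)] that(2), symmetric] by simp
  then show "homogeneous_prime (quotient_group \<Gamma>) (overring \<Gamma> RP RP_grading T)
      (overring_grading \<Gamma> RP RP_grading T) (reduce ` Q)"
    using image(1) by (simp add: RP.overring_homogeneous_prime_iff[OF T])
qed

text \<open>
  Reducing and contracting commute because \<open>reduce\<close> sends the image of \<open>x\<close> in \<open>RH\<close> to the image of its
  coset in \<open>RP.RH\<close>.
\<close>

lemma contraction_reduce: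
  assumes emb: "embed \<Gamma> R \<G> ` carrier R \<subseteq> pullback T"
    and iff: "\<And>U. U \<in> pullback T \<Longrightarrow> U \<in> Q \<longleftrightarrow> reduce U \<in> q"
  shows "contraction \<Gamma> R \<G> Q = {x \<in> carrier R. P +> x \<in> contraction \<Gamma> RP RP_grading q}"
  using assms by (auto simp: contraction_def reduce_embed)

lemma coset_vimage_cancel:
  assumes "p \<subseteq> carrier RP" "p' \<subseteq> carrier RP"
    and "{x \<in> carrier R. P +> x \<in> p} = {x \<in> carrier R. P +> x \<in> p'}"
  shows "p = p'"
proof -
  have "X \<in> p \<longleftrightarrow> X \<in> p'" if "X \<in> carrier RP" for X
    using that
  proof (rule coset_cases)
    fix x assume "x \<in> carrier R" "X = P +> x"
    then show ?thesis using assms(3) by blast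
  qed
  then show ?thesis using assms(1,2) by blast
qed

text \<open>
  Lift all data to \<open>R\<close> and the pullback of \<open>T\<close>, where going-down yields a prime \<open>Q0\<close>. By
  \<open>kernel_subset_prime\<close>, either it contains the kernel of \<open>reduce\<close> and its image is as required, or it
  is contained in the kernel. In the latter case the preimage of \<open>p0\<close> is contained in \<open>P\<close>, so \<open>p0\<close> is zero
  and lies below the zero ideal of \<open>T\<close>.
\<close>

theorem gGD_reduce:
  assumes T: "homogeneous_overring \<Gamma> RP RP_grading T"
    and gGD: "gGD \<Gamma> R \<G> (pullback T)"
  shows "gGD \<Gamma> RP RP_grading T"
  unfolding gGD_def
proof (intro allI impI, elim conjE)
  fix p0 p q
  assume p0: "homogeneous_prime \<Gamma> RP RP_grading p0" and p: "homogeneous_prime \<Gamma> RP RP_grading p"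
    and le: "p0 \<subseteq> p"
    and q: "homogeneous_prime (quotient_group \<Gamma>) (overring \<Gamma> RP RP_grading T)
      (overring_grading \<Gamma> RP RP_grading T) q"
    and contr: "contraction \<Gamma> RP RP_grading q = p"
  let ?v = "\<lambda>p. {x \<in> carrier R. P +> x \<in> p}"
  let ?q = "{U \<in> pullback T. reduce U \<in> q}"
  have over: "homogeneous_overring \<Gamma> R \<G> (pullback T)" by (rule pullback_overring[OF T])
  then have emb: "embed \<Gamma> R \<G> ` carrier R \<subseteq> pullback T" by (simp add: homogeneous_overring_iff)
  have p0c: "p0 \<subseteq> carrier RP"
    using p0 additive_subgroup.a_subset ideal.axioms(1) primeideal.axioms(1)
    unfolding homogeneous_prime_def by blast
  have "contraction \<Gamma> R \<G> ?q = ?v p"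
    unfolding contr[symmetric] by (rule contraction_reduce[OF emb]) simp
  then obtain Q0 where Q0: "homogeneous_prime (quotient_group \<Gamma>) (overring \<Gamma> R \<G> (pullback T))
      (overring_grading \<Gamma> R \<G> (pullback T)) Q0" "Q0 \<subseteq> ?q" "contraction \<Gamma> R \<G> Q0 = ?v p0"
    using gGD[unfolded gGD_def, rule_format, of "?v p0" "?v p" ?q] le
      homogeneous_prime_vimage_coset[OF p0] homogeneous_prime_vimage_coset[OF p]
      homogeneous_prime_vimage_reduce[OF T q] by blast
  show "\<exists>q0. homogeneous_prime (quotient_group \<Gamma>) (overring \<Gamma> RP RP_grading T)
      (overring_grading \<Gamma> RP RP_grading T) q0 \<and> q0 \<subseteq> q \<and> contraction \<Gamma> RP RP_grading q0 = p0"
  proof (cases "\<exists>y\<in>Q0. reduce y \<noteq> \<zero>\<^bsub>RP.RH\<^esub>")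
    case True
    then obtain y where y: "y \<in> Q0" "reduce y \<noteq> \<zero>\<^bsub>RP.RH\<^esub>" by blast
    have kernel: "m \<in> Q0" if "m \<in> localization" "reduce m = \<zero>\<^bsub>RP.RH\<^esub>" for m
      by (rule kernel_subset_prime[OF T Q0(1) y that])
    note image = homogeneous_prime_image_reduce[OF T Q0(1) kernel]
    have "contraction \<Gamma> R \<G> Q0 = ?v (contraction \<Gamma> RP RP_grading (reduce ` Q0))"
      by (rule contraction_reduce[OF emb]) (rule image(2)[symmetric])
    then have "contraction \<Gamma> RP RP_grading (reduce ` Q0) = p0"
      using Q0(3) p0c by (intro coset_vimage_cancel) (auto simp: contraction_def)
    moreover have "reduce ` Q0 \<subseteq> q" using Q0(2) by blast
    ultimately show ?thesis using image(1) by blast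
  next
    case False
    let ?z = "{\<zero>\<^bsub>RP.RH\<^esub>}"
    have embed_zero: "embed \<Gamma> RP RP_grading X = \<zero>\<^bsub>RP.RH\<^esub> \<longleftrightarrow> X = \<zero>\<^bsub>RP\<^esub>"
      if "X \<in> carrier RP" for X
      using that RP.frac_eq_zero RP.frac.S_one by (simp add: embed_def)
    have "p0 \<subseteq> {\<zero>\<^bsub>RP\<^esub>}"
    proof
      fix X assume X: "X \<in> p0"
      then have Xc: "X \<in> carrier RP" using p0c by blast
      then obtain x where x: "x \<in> carrier R" "X = P +> x" by (rule coset_cases)
      then have "x \<in> contraction \<Gamma> R \<G> Q0" using X Q0(3) by blast
      then have "embed \<Gamma> R \<G> x \<in> Q0" by (simp add: contraction_def)
      then have "embed \<Gamma> RP RP_grading X = \<zero>\<^bsub>RP.RH\<^esub>" using False x reduce_embed(2) by metis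
      then show "X \<in> {\<zero>\<^bsub>RP\<^esub>}" using embed_zero[OF Xc] by blast
    qed
    moreover have ideals: "ideal p0 RP" "ideal q (overring \<Gamma> RP RP_grading T)"
      using p0 q primeideal.axioms(1) unfolding homogeneous_prime_def by blast+
    moreover have "\<zero>\<^bsub>RP\<^esub> \<in> p0"
      using additive_subgroup.zero_closed[OF ideal.axioms(1)[OF ideals(1)]] .
    ultimately have p0z: "p0 = {\<zero>\<^bsub>RP\<^esub>}" by blast
    have "contraction \<Gamma> RP RP_grading ?z = p0"
      unfolding contraction_def p0z using embed_zero RP.zero_closed by blast
    moreover have "?z \<subseteq> q"
      using additive_subgroup.zero_closed[OF ideal.axioms(1)[OF ideals(2)]] by simp
    moreover have "homogeneous_prime (quotient_group \<Gamma>) (overring \<Gamma> RP RP_grading T)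
        (overring_grading \<Gamma> RP RP_grading T) ?z"
    proof -
      have "domain (overring \<Gamma> RP RP_grading T)"
        using T RP.RH.subring_is_domain by (simp add: RP.homogeneous_overring_iff)
      from domain.zeroprimeideal[OF this] have "primeideal ?z (overring \<Gamma> RP RP_grading T)"
        by simp
      then show ?thesis
        by (simp add: RP.overring_homogeneous_prime_iff[OF T] RP.RH.component_zero)
    qed
    ultimately show ?thesis by blast
  qed
qed

end

theorem corollary4p8:
  fixes \<Gamma> :: "('g, 'm) monoid_scheme" and R :: "('a, 'n) ring_scheme"
    and \<G> :: "'g \<Rightarrow> 'a set" and P :: "'a set"
  assumes "gGD_domain \<Gamma> R \<G>"
    and "homogeneous_prime \<Gamma> R \<G> P"
  shows "gGD_domain \<Gamma> (R Quot P) (quotient_grading R \<G> P)"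
proof -
  interpret graded_quotient \<Gamma> R \<G> P
    using assms
    by (simp add: graded_quotient_def graded_quotient_axioms_def gGD_domain_def)
  show ?thesis
    unfolding gGD_domain_def
  proof (intro conjI allI impI)
    show "graded_domain \<Gamma> RP RP_grading" by (rule RP.graded_domain_axioms)
    fix T assume T: "homogeneous_overring \<Gamma> RP RP_grading T"
    then have "gGD \<Gamma> R \<G> (pullback T)"
      using assms(1) pullback_overring by (simp add: gGD_domain_def)
    then show "gGD \<Gamma> RP RP_grading T" by (rule gGD_reduce[OF T])
  qed
qed

end
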